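(* In $\mathbb{R}^3$, there exists a trapped non-normal 2-parameter family of rays; that is, there exist a trap in $\mathbb{R}^3$ and a 2-dimensional smooth embedded submanifold $F\subset L_3$ that is a trapped family of rays for this trap and is non-normal.
   Context: $L_3=\{(u,p): u\in S^{2},\ p\in u^\perp\}$ is the space of oriented lines in $\mathbb{R}^3$; $(u,p)$ represents the line $p+\mathbb{R}u$ traversed in direction $u$. It is a smooth manifold of dimension $4$. A trap is a finite collection of compact embedded $C^\infty$ hypersurfaces (the mirrors, each possibly with boundary) in $\mathbb{R}^3$. Rays move along straight lines at unit speed and are reflected specularly at interior points of the mirrors. A trajectory is nonsingular if it has no tangential collisions with the mirrors, no collisions with the boundaries of the mirrors, no multiple collisions (simultaneous collisions with more than one mirror), and no accumulation of collisions in finite time. Let $F\subset L_3$ be a smooth embedded submanifold. $F$ is a trapped family of rays (for a given trap) if there is a ball $B_R$ containing the trap in its interior such that, for every $\ell\in F$, the billiard trajectory coming from infinity along $\ell$ enters $B_R$, remains within $B_R$ for all subsequent time, and is nonsingular. A 2-parameter family $U\subset L_3$ (a 2-dimensional embedded submanifold) is locally normal to a smooth surface if every line in $U$ has a neighborhood $V$ in $U$ for which there is a smooth surface in $\mathbb{R}^3$, with smooth unit normal field, such that sending each point of the surface to its oriented normal line is a diffeomorphism from the surface onto $V$. The family is non-normal if it is not locally normal to any smooth surface in this sense. *)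

theory Defs
  imports "HOL-Analysis.Analysis"
begin

section \<open>Smooth maps and embedded submanifolds of Euclidean spaces\<close>

primrec Ck_on :: "nat \<Rightarrow> ('a::euclidean_space \<Rightarrow> 'b::euclidean_space) \<Rightarrow> 'a set \<Rightarrow> bool" where
  "Ck_on 0 f S \<longleftrightarrow> continuous_on S f"
| "Ck_on (Suc k) f S \<longleftrightarrow>
     (\<forall>x\<in>S. f differentiable (at x)) \<and> (\<forall>v. Ck_on k (\<lambda>x. frechet_derivative f (at x) v) S)"

text \<open>Smoothness on an arbitrary set means local extendability to a \<open>C\<^sup>\<infinity>\<close> map on an open set;
  \<^term>\<open>Ck_on\<close> is only used on open sets.\<close>

definition smooth_on :: "('a::euclidean_space \<Rightarrow> 'b::euclidean_space) \<Rightarrow> 'a set \<Rightarrow> bool" where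
  "smooth_on f S \<longleftrightarrow>
     (\<forall>x\<in>S. \<exists>U g. open U \<and> x \<in> U \<and> (\<forall>k. Ck_on k g U) \<and> (\<forall>y\<in>U \<inter> S. g y = f y))"

definition diffeomorphism ::
    "'a::euclidean_space set \<Rightarrow> 'b::euclidean_space set \<Rightarrow> ('a \<Rightarrow> 'b) \<Rightarrow> ('b \<Rightarrow> 'a) \<Rightarrow> bool" where
  "diffeomorphism S T f g \<longleftrightarrow>
     smooth_on f S \<and> smooth_on g T \<and> f ` S = T \<and> g ` T = S \<and>
     (\<forall>x\<in>S. g (f x) = x) \<and> (\<forall>y\<in>T. f (g y) = y)"

text \<open>Charts are ambient diffeomorphisms straightening the set to a \<open>k\<close>-dimensional linear
  subspace, or to a closed half of one with the given point going to the edge of the half-space.\<close>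

definition interior_chart_at :: "nat \<Rightarrow> 'a::euclidean_space set \<Rightarrow> 'a \<Rightarrow> bool" where
  "interior_chart_at k M x \<longleftrightarrow>
     (\<exists>U V \<phi> \<psi> (L :: 'a set). open U \<and> x \<in> U \<and> open V \<and> diffeomorphism U V \<phi> \<psi> \<and>
        subspace L \<and> dim L = k \<and> \<phi> ` (U \<inter> M) = V \<inter> L)"

definition boundary_chart_at :: "nat \<Rightarrow> 'a::euclidean_space set \<Rightarrow> 'a \<Rightarrow> bool" where
  "boundary_chart_at k M x \<longleftrightarrow>
     (\<exists>U V \<phi> \<psi> (L :: 'a set) e. open U \<and> x \<in> U \<and> open V \<and> diffeomorphism U V \<phi> \<psi> \<and>
        subspace L \<and> dim L = k \<and> e \<in> L \<and> e \<noteq> 0 \<and> e \<bullet> \<phi> x = 0 \<and>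
        \<phi> ` (U \<inter> M) = V \<inter> {y \<in> L. 0 \<le> e \<bullet> y})"

definition embedded_submanifold :: "nat \<Rightarrow> 'a::euclidean_space set \<Rightarrow> bool" where
  "embedded_submanifold k M \<longleftrightarrow> (\<forall>x\<in>M. interior_chart_at k M x)"

definition embedded_submanifold_with_boundary :: "nat \<Rightarrow> 'a::euclidean_space set \<Rightarrow> bool" where
  "embedded_submanifold_with_boundary k M \<longleftrightarrow>
     (\<forall>x\<in>M. interior_chart_at k M x \<or> boundary_chart_at k M x)"

definition manifold_interior :: "nat \<Rightarrow> 'a::euclidean_space set \<Rightarrow> 'a set" where
  "manifold_interior k M = {x \<in> M. interior_chart_at k M x}"

definition manifold_boundary :: "nat \<Rightarrow> 'a::euclidean_space set \<Rightarrow> 'a set" where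
  "manifold_boundary k M = M - manifold_interior k M"

text \<open>Velocities of smooth curves in \<open>M\<close>.  This is the tangent space at interior points, and it
  is only relevant there.\<close>

definition tangent_space :: "'a::euclidean_space set \<Rightarrow> 'a \<Rightarrow> 'a set" where
  "tangent_space M x =
     {v. \<exists>c \<epsilon>. 0 < \<epsilon> \<and> smooth_on c {-\<epsilon><..<\<epsilon>} \<and> c ` {-\<epsilon><..<\<epsilon>} \<subseteq> M \<and> c 0 = x \<and>
           (c has_vector_derivative v) (at (0::real))}"

definition unit_normal_at :: "'a::euclidean_space set \<Rightarrow> 'a \<Rightarrow> 'a \<Rightarrow> bool" where
  "unit_normal_at M x n \<longleftrightarrow> norm n = 1 \<and> (\<forall>v\<in>tangent_space M x. n \<bullet> v = 0)"

section \<open>Oriented lines and normal families\<close>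

text \<open>The pair \<open>(u, p)\<close> stands for the line \<open>p + \<real>u\<close> traversed in direction \<open>u\<close>.
  This set is a 4-dimensional embedded submanifold of the ambient 6-dimensional space, so the
  embedded submanifolds of it are exactly the embedded submanifolds of the ambient space
  that it contains.\<close>

definition L3 :: "((real^3) \<times> (real^3)) set" where
  "L3 = {(u, p). norm u = 1 \<and> u \<bullet> p = 0}"

text \<open>The line through \<open>x\<close> with unit direction \<open>u\<close>.\<close>

definition oriented_line :: "real^3 \<Rightarrow> real^3 \<Rightarrow> (real^3) \<times> (real^3)" where
  "oriented_line u x = (u, x - (x \<bullet> u) *\<^sub>R u)"

definition locally_normal :: "((real^3) \<times> (real^3)) set \<Rightarrow> bool" where
  "locally_normal F \<longleftrightarrow>
     (\<forall>l\<in>F. \<exists>V. openin (top_of_set F) V \<and> l \<in> V \<and>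
        (\<exists>S N g. embedded_submanifold 2 S \<and> smooth_on N S \<and> (\<forall>x\<in>S. unit_normal_at S x (N x)) \<and>
           diffeomorphism S V (\<lambda>x. oriented_line (N x) x) g))"

definition non_normal :: "((real^3) \<times> (real^3)) set \<Rightarrow> bool" where
  "non_normal F \<longleftrightarrow> \<not> locally_normal F"

section \<open>Billiard trajectories and trapped families\<close>

definition trap :: "(real^3) set set \<Rightarrow> bool" where
  "trap T \<longleftrightarrow> finite T \<and> (\<forall>M\<in>T. compact M \<and> embedded_submanifold_with_boundary 2 M)"

text \<open>Trajectories are parametrised by arc length over all times, so that before the first
  collision the position at time \<open>t\<close> is \<open>p + t u\<close>.  The three conditions are: the ray comes from
  infinity along \<open>l\<close>; it moves straight at unit speed between collisions; it is reflected
  specularly at interior points of mirrors, \<open>v\<close> and \<open>w\<close> being the velocities before and after.\<close>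

definition billiard_trajectory ::
    "(real^3) set set \<Rightarrow> (real^3) \<times> (real^3) \<Rightarrow> (real \<Rightarrow> real^3) \<Rightarrow> bool" where
  "billiard_trajectory T l \<gamma> \<longleftrightarrow>
     (\<exists>t\<^sub>0. \<forall>t\<le>t\<^sub>0. \<gamma> t = snd l + t *\<^sub>R fst l) \<and>
     (\<forall>a b. a < b \<and> (\<forall>t\<in>{a<..<b}. \<gamma> t \<notin> \<Union>T) \<longrightarrow>
        (\<exists>w. norm w = 1 \<and> (\<forall>t\<in>{a..b}. \<gamma> t = \<gamma> a + (t - a) *\<^sub>R w))) \<and>
     (\<forall>t. \<forall>M\<in>T. \<gamma> t \<in> manifold_interior 2 M \<longrightarrow>
        (\<exists>v w n. (\<gamma> has_vector_derivative v) (at_left t) \<and>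
           (\<gamma> has_vector_derivative w) (at_right t) \<and>
           unit_normal_at M (\<gamma> t) n \<and> w = v - (2 * (v \<bullet> n)) *\<^sub>R n))"

text \<open>In order: no tangential collisions, no collisions with boundaries, no multiple collisions,
  no accumulation of collisions in finite time.\<close>

definition nonsingular :: "(real^3) set set \<Rightarrow> (real \<Rightarrow> real^3) \<Rightarrow> bool" where
  "nonsingular T \<gamma> \<longleftrightarrow>
     (\<forall>t. \<forall>M\<in>T. \<forall>v. \<gamma> t \<in> M \<and> (\<gamma> has_vector_derivative v) (at_left t) \<longrightarrow>
        v \<notin> tangent_space M (\<gamma> t)) \<and>
     (\<forall>t. \<forall>M\<in>T. \<gamma> t \<notin> manifold_boundary 2 M) \<and>
     (\<forall>t. \<forall>M\<in>T. \<forall>M'\<in>T. \<gamma> t \<in> M \<and> \<gamma> t \<in> M' \<longrightarrow> M = M') \<and>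
     (\<forall>a b. finite {t \<in> {a..b}. \<gamma> t \<in> \<Union>T})"

text \<open>A nonsingular trajectory is determined by its incoming line, so the existential
  quantifier over \<open>\<gamma>\<close> below speaks about the trajectory along \<open>l\<close>; \<open>t\<^sub>0\<close> is the time at
  which it enters the ball.\<close>

definition trapped_family :: "(real^3) set set \<Rightarrow> ((real^3) \<times> (real^3)) set \<Rightarrow> bool" where
  "trapped_family T F \<longleftrightarrow>
     F \<subseteq> L3 \<and> (\<exists>k. embedded_submanifold k F) \<and>
     (\<exists>c R. \<Union>T \<subseteq> ball c R \<and>
        (\<forall>l\<in>F. \<exists>\<gamma>. billiard_trajectory T l \<gamma> \<and> nonsingular T \<gamma> \<and>
           (\<exists>t\<^sub>0. \<forall>t. \<gamma> t \<in> cball c R \<longleftrightarrow> t\<^sub>0 \<le> t)))"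

end

theory Submission
  imports Defs
begin

text \<open>The mirror is a band around the equator of the oblate ellipsoid \<open>x\<^sup>2 + y\<^sup>2 + 2 z\<^sup>2 = 2\<close>, whose
  meridian ellipses have their foci on the unit circle of the plane \<open>z = 0\<close>.  Reflection in the
  ellipsoid preserves the set of lines meeting this focal circle.  If such a ray crosses the circle
  outwards, it does so after every reflection, and the heights of its successive hits decrease in
  absolute value, so that a ray entering through a polar opening never leaves.  The trapped
  lines obtained in this way form a 3-dimensional family; fixing the slope cuts out a surface that is
  not Lagrangian, and therefore not normal.\<close>

section \<open>Smooth calculus\<close>

text \<open>The focal circle bounds the disc to which the confocal quadrics
  \<open>(x^2 + y^2)/(2 + k) + z^2/(1 + k) = 1\<close> collapse at \<open>k = -1\<close>. This is
  why the invariance also holds for lines outside the meridian planes, where the planar focal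
  property does not apply; here it is checked by direct computation. The distance from the circle to
  a hit is below 1 for an outgoing ray, so the distance back to the circle exceeds 1. This one
  estimate does three jobs: it makes the heights decrease, keeps the ray outgoing, and separates the
  hits by more than unit time, which excludes accumulation. For non-normality, let
  \<open>foc y\<close> be the focal point and \<open>udir s\<close> the direction. The canonical
  2-form on the space of lines, the sum of \<open>du_i\<close> wedge \<open>dp_i\<close>, pulls back
  up to sign to the inner product of \<open>foc' y\<close> and \<open>udir' s\<close> times the area
  form. It equals the area form up to sign at the origin, because both curves move in the second
  coordinate direction there. The proof meets this form as the mixed derivative of a distance
  function.\<close>

lemma Ck_on_subset: "Ck_on k f S \<Longrightarrow> T \<subseteq> S \<Longrightarrow> Ck_on k f T"
  by (induction k arbitrary: f) (auto intro: continuous_on_subset)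

lemma Ck_on_imp_continuous_on: "Ck_on k f S \<Longrightarrow> continuous_on S f"
  by (cases k)
    (auto intro!: continuous_at_imp_continuous_on differentiable_imp_continuous_within)

lemma Ck_on_SucD: "Ck_on (Suc k) f S \<Longrightarrow> Ck_on k f S"
proof (induction k arbitrary: f)
  case 0
  then show ?case using Ck_on_imp_continuous_on by fastforce
next
  case (Suc k)
  then show ?case by (metis Ck_on.simps(2))
qed

text \<open>On an open set a derivative depends only on nearby values in the set, so agreement
  passes to the derivatives and the induction continues.\<close>

lemma Ck_on_cong:
  assumes "open S" "\<And>x. x \<in> S \<Longrightarrow> f x = g x" "Ck_on k f S"
  shows "Ck_on k g S"
  using assms(2,3)
proof (induction k arbitrary: f g)
  case 0
  then show ?case by (auto cong: continuous_on_cong)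
next
  case (Suc k)
  have d: "(g has_derivative frechet_derivative f (at x)) (at x)" if "x \<in> S" for x
  proof -
    have "(f has_derivative frechet_derivative f (at x)) (at x)"
      using Suc.prems(2) that by (metis Ck_on.simps(2) frechet_derivative_works)
    then show ?thesis
      using has_derivative_transform_within_open[OF _ assms(1) that] Suc.prems(1) by blast
  qed
  have eq: "frechet_derivative f (at x) v = frechet_derivative g (at x) v" if "x \<in> S" for x v
    using frechet_derivative_at[OF d[OF that]] by (rule fun_cong)
  have "Ck_on k (\<lambda>x. frechet_derivative f (at x) v) S" for v
    using Suc.prems(2) by simp
  from Suc.IH[OF eq this] have "Ck_on k (\<lambda>x. frechet_derivative g (at x) v) S" for v .
  moreover have "g differentiable (at x)" if "x \<in> S" for x
    using d[OF that] by (rule differentiableI)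
  ultimately show ?case by simp
qed

text \<open>Any explicit derivative may be supplied, so later inductions need not evaluate
  \<open>frechet_derivative\<close> of a compound term.\<close>

lemma Ck_on_SucI:
  assumes "open S" "\<And>x. x \<in> S \<Longrightarrow> (f has_derivative f' x) (at x)"
    and "\<And>v. Ck_on k (\<lambda>x. f' x v) S"
  shows "Ck_on (Suc k) f S"
proof -
  have eq: "f' x v = frechet_derivative f (at x) v" if "x \<in> S" for x v
    using frechet_derivative_at[OF assms(2)[OF that]] by (rule fun_cong)
  have "Ck_on k (\<lambda>x. frechet_derivative f (at x) v) S" for v
    by (rule Ck_on_cong[OF assms(1) eq assms(3)])
  moreover have "f differentiable (at x)" if "x \<in> S" for x
    using assms(2)[OF that] by (rule differentiableI)
  ultimately show ?thesis by simp
qed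

lemma Ck_on_has_derivative:
  "Ck_on (Suc k) f S \<Longrightarrow> x \<in> S \<Longrightarrow> (f has_derivative frechet_derivative f (at x)) (at x)"
  by (metis Ck_on.simps(2) frechet_derivative_works)

lemma Ck_on_const: "open S \<Longrightarrow> Ck_on k (\<lambda>x. c) S"
proof (induction k arbitrary: c)
  case (Suc k)
  show ?case by (rule Ck_on_SucI[where f' = "\<lambda>x v. 0"]) (use Suc in auto)
qed auto

lemma Ck_on_bounded_linear:
  assumes "open S" "bounded_linear h" "Ck_on k f S"
  shows "Ck_on k (\<lambda>x. h (f x)) S"
  using assms(3)
proof (induction k arbitrary: f)
  case 0
  then show ?case using bounded_linear.continuous_on[OF assms(2)] unfolding Ck_on.simps by blast
next
  case (Suc k)
  show ?case
    by (rule Ck_on_SucI[OF assms(1) bounded_linear.has_derivative[OF assms(2) Ck_on_has_derivative[OF Suc.prems]]])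
       (use Suc in auto)
qed

lemma Ck_on_id: "open S \<Longrightarrow> Ck_on k (\<lambda>x. x) S"
proof (cases k)
  case (Suc m)
  assume "open S"
  then show ?thesis unfolding Suc
    by (intro Ck_on_SucI[where f' = "\<lambda>x v. v"]) (auto intro: Ck_on_const)
qed auto

lemma Ck_on_add:
  assumes "open S" "Ck_on k f S" "Ck_on k g S"
  shows "Ck_on k (\<lambda>x. f x + g x) S"
  using assms(2,3)
proof (induction k arbitrary: f g)
  case 0
  then show ?case by (simp add: continuous_on_add)
next
  case (Suc k)
  show ?case
    by (rule Ck_on_SucI[OF assms(1) has_derivative_add[OF Ck_on_has_derivative[OF Suc.prems(1)]
          Ck_on_has_derivative[OF Suc.prems(2)]]])
       (use Suc in auto)
qed

lemma Ck_on_bilinear: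
  assumes "open S" "bounded_bilinear h" "Ck_on k f S" "Ck_on k g S"
  shows "Ck_on k (\<lambda>x. h (f x) (g x)) S"
  using assms(3,4)
proof (induction k arbitrary: f g)
  case 0
  then show ?case using bounded_bilinear.continuous_on[OF assms(2)] unfolding Ck_on.simps by blast
next
  case (Suc k)
  have "Ck_on k (\<lambda>x. frechet_derivative f (at x) v) S"
    "Ck_on k (\<lambda>x. frechet_derivative g (at x) v) S" for v
    using Suc.prems by simp_all
  then have c: "Ck_on k (\<lambda>x. h (f x) (frechet_derivative g (at x) v) +
      h (frechet_derivative f (at x) v) (g x)) S" for v
    by (intro Ck_on_add assms(1) Suc.IH Suc.prems[THEN Ck_on_SucD])
  have d: "((\<lambda>x. h (f x) (g x)) has_derivative (\<lambda>v. h (f x) (frechet_derivative g (at x) v) +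
      h (frechet_derivative f (at x) v) (g x))) (at x)" if "x \<in> S" for x
    by (rule bounded_bilinear.FDERIV[OF assms(2) Suc.prems[THEN Ck_on_has_derivative, OF that]])
  show ?case by (rule Ck_on_SucI[OF assms(1) d c])
qed

lemmas Ck_on_mult = Ck_on_bilinear[OF _ bounded_bilinear_mult]
lemmas Ck_on_scaleR = Ck_on_bilinear[OF _ bounded_bilinear_scaleR]
lemmas Ck_on_inner = Ck_on_bilinear[OF _ bounded_bilinear_inner]
lemmas Ck_on_minus = Ck_on_bounded_linear[OF _ bounded_linear_minus[OF bounded_linear_ident]]
lemmas Ck_on_fst = Ck_on_bounded_linear[OF _ bounded_linear_fst]
lemmas Ck_on_snd = Ck_on_bounded_linear[OF _ bounded_linear_snd]
lemmas Ck_on_nth = Ck_on_bounded_linear[OF _ bounded_linear_vec_nth]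

lemma Ck_on_diff:
  assumes "open S" "Ck_on k f S" "Ck_on k g S"
  shows "Ck_on k (\<lambda>x. f x - g x) S"
  using Ck_on_add[OF assms(1,2) Ck_on_minus[OF assms(1,3)]] by simp

lemma Ck_on_power:
  fixes f :: "'a::euclidean_space \<Rightarrow> real"
  assumes "open S" "Ck_on k f S"
  shows "Ck_on k (\<lambda>x. f x ^ n) S"
  by (induction n) (simp_all add: Ck_on_const Ck_on_mult assms)

lemma Ck_on_sum:
  assumes "open S" "\<And>i. i \<in> I \<Longrightarrow> Ck_on k (f i) S"
  shows "Ck_on k (\<lambda>x. \<Sum>i\<in>I. f i x) S"
  using assms(2)
  by (induction I rule: infinite_finite_induct) (auto simp: Ck_on_const Ck_on_add assms(1))

lemma Ck_on_Pair:
  assumes "open S" "Ck_on k f S" "Ck_on k g S"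
  shows "Ck_on k (\<lambda>x. (f x, g x)) S"
proof -
  have "bounded_linear (\<lambda>y. (y, 0))" "bounded_linear (\<lambda>y. (0, y))"
    by (auto intro: bounded_linear_Pair)
  then have "Ck_on k (\<lambda>x. (f x, 0) + (0, g x)) S"
    by (intro Ck_on_add assms(1) Ck_on_bounded_linear[OF _ _ assms(2)]
        Ck_on_bounded_linear[OF _ _ assms(3)])
  then show ?thesis by simp
qed

lemma Ck_on_vec:
  fixes f :: "'a::euclidean_space \<Rightarrow> real^'n"
  assumes "open S" "\<And>i. Ck_on k (\<lambda>x. f x $ i) S"
  shows "Ck_on k f S"
proof -
  have "Ck_on k (\<lambda>x. \<Sum>i\<in>UNIV. f x $ i *\<^sub>R axis i 1 :: real^'n) S"
    by (intro Ck_on_sum Ck_on_scaleR Ck_on_const assms)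
  moreover have "(\<Sum>i\<in>UNIV. y $ i *\<^sub>R axis i 1) = y" for y :: "real^'n"
    using basis_expansion[of y] unfolding scalar_mult_eq_scaleR .
  ultimately show ?thesis by (simp only:)
qed

lemma Ck_on_vector_3:
  assumes "open S" "Ck_on k a S" "Ck_on k b S" "Ck_on k c S"
  shows "Ck_on k (\<lambda>x. vector [a x, b x, c x] :: real^3) S"
proof (rule Ck_on_vec[OF assms(1)])
  fix i :: 3
  show "Ck_on k (\<lambda>x. (vector [a x, b x, c x] :: real^3) $ i) S"
    using exhaust_3[of i] assms(2-4) by auto
qed

lemma Ck_on_compose:
  assumes "open S" "open T" "Ck_on k f S" "Ck_on k g T" "f ` S \<subseteq> T"
  shows "Ck_on k (\<lambda>x. g (f x)) S"
  using assms(3,4)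
proof (induction k arbitrary: g)
  case 0
  then show ?case using assms(5) by (auto intro: continuous_on_compose2)
next
  case (Suc k)
  let ?f' = "\<lambda>x. frechet_derivative f (at x)" and ?g' = "\<lambda>y. frechet_derivative g (at y)"
  have df: "(f has_derivative ?f' x) (at x)" if "x \<in> S" for x
    using Ck_on_has_derivative[OF Suc.prems(1) that] .
  have dg: "(g has_derivative ?g' (f x)) (at (f x))" if "x \<in> S" for x
    using Ck_on_has_derivative[OF Suc.prems(2)] that assms(5) by auto
  have d: "((\<lambda>x. g (f x)) has_derivative (\<lambda>v. ?g' (f x) (?f' x v))) (at x)" if "x \<in> S" for x
    using has_derivative_compose[OF df[OF that] dg[OF that]] .
  \<comment> \<open>After the chain rule the outer derivative is applied to a direction that varies
    with \<open>x\<close>, whereas the induction hypothesis concerns fixed directions. Expanding in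
    the basis separates the two.\<close>
  have e: "(\<Sum>b\<in>Basis. (?f' x v \<bullet> b) *\<^sub>R ?g' (f x) b) = ?g' (f x) (?f' x v)"
    if "x \<in> S" for x v
  proof -
    interpret bounded_linear "?g' (f x)" using dg[OF that] by (rule has_derivative_bounded_linear)
    have "?g' (f x) (?f' x v) = ?g' (f x) (\<Sum>b\<in>Basis. (?f' x v \<bullet> b) *\<^sub>R b)"
      by (simp add: euclidean_representation)
    also have "\<dots> = (\<Sum>b\<in>Basis. (?f' x v \<bullet> b) *\<^sub>R ?g' (f x) b)"
      by (simp add: sum scaleR)
    finally show ?thesis by simp
  qed
  have "Ck_on k (\<lambda>x. \<Sum>b\<in>Basis. (?f' x v \<bullet> b) *\<^sub>R ?g' (f x) b) S" for v
    using Suc.prems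
    by (intro Ck_on_sum Ck_on_scaleR Ck_on_inner Ck_on_const assms(1) Suc.IH)
       (auto intro: Ck_on_SucD)
  from Ck_on_cong[OF assms(1) e this]
  have "Ck_on k (\<lambda>x. ?g' (f x) (?f' x v)) S" for v .
  from Ck_on_SucI[OF assms(1) d this] show ?case .
qed

text \<open>The derivative is a polynomial in \<open>inverse\<close> itself, so the induction on
  \<open>k\<close> closes. The square root below follows the same pattern.\<close>

lemma Ck_on_inverse_real: "Ck_on k inverse {0::real<..}"
proof (induction k)
  case 0
  show ?case by (auto intro!: continuous_intros)
next
  case (Suc k)
  have "(inverse has_derivative (\<lambda>v. - (inverse x * v * inverse x))) (at x)"
    if "x \<in> {0<..}" for x :: real
    using that by (intro has_derivative_inverse') auto
  moreover have "Ck_on k (\<lambda>x::real. - (inverse x * v * inverse x)) {0<..}" for v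
    by (intro Ck_on_minus Ck_on_mult Ck_on_const Suc open_greaterThan)
  ultimately show ?case by (intro Ck_on_SucI open_greaterThan)
qed

lemma Ck_on_inverse:
  fixes f :: "'a::euclidean_space \<Rightarrow> real"
  assumes "open S" "Ck_on k f S" "\<And>x. x \<in> S \<Longrightarrow> 0 < f x"
  shows "Ck_on k (\<lambda>x. inverse (f x)) S"
  by (rule Ck_on_compose[OF assms(1) _ assms(2) Ck_on_inverse_real]) (use assms(3) in auto)

lemma Ck_on_divide:
  fixes f g :: "'a::euclidean_space \<Rightarrow> real"
  assumes "open S" "Ck_on k f S" "Ck_on k g S" "\<And>x. x \<in> S \<Longrightarrow> 0 < g x"
  shows "Ck_on k (\<lambda>x. f x / g x) S"
  unfolding divide_inverse by (intro Ck_on_mult Ck_on_inverse assms)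

lemma Ck_on_sqrt_real: "Ck_on k sqrt {0<..}"
proof (induction k)
  case 0
  show ?case by (auto intro!: continuous_intros)
next
  case (Suc k)
  have "(sqrt has_derivative (\<lambda>v. inverse (sqrt x) / 2 * v)) (at x)" if "x \<in> {0<..}" for x
    using DERIV_real_sqrt[of x] that unfolding has_field_derivative_def greaterThan_iff by blast
  moreover have "Ck_on k (\<lambda>x. inverse (sqrt x) / 2 * v) {0<..}" for v
    by (intro Ck_on_mult Ck_on_divide Ck_on_inverse Suc Ck_on_const open_greaterThan) auto
  ultimately show ?case by (intro Ck_on_SucI open_greaterThan)
qed

lemma Ck_on_sqrt:
  assumes "open S" "Ck_on k f S" "\<And>x. x \<in> S \<Longrightarrow> 0 < f x"
  shows "Ck_on k (\<lambda>x. sqrt (f x)) S"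
  by (rule Ck_on_compose[OF assms(1) _ assms(2) Ck_on_sqrt_real]) (use assms(3) in auto)

lemmas Ck_on_intros = Ck_on_const Ck_on_id Ck_on_add Ck_on_diff Ck_on_minus Ck_on_mult
  Ck_on_scaleR Ck_on_inner Ck_on_power Ck_on_divide Ck_on_sqrt Ck_on_fst Ck_on_snd Ck_on_nth
  Ck_on_Pair

section \<open>Smooth maps on arbitrary sets and diffeomorphisms\<close>

lemma smooth_on_open:
  assumes "open S" "\<And>k. Ck_on k f S"
  shows "smooth_on f S"
  unfolding smooth_on_def
proof
  fix x assume "x \<in> S"
  then show "\<exists>U g. open U \<and> x \<in> U \<and> (\<forall>k. Ck_on k g U) \<and> (\<forall>y\<in>U \<inter> S. g y = f y)"
    using assms by (intro exI[of _ S] exI[of _ f]) simp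
qed

lemma smooth_onE:
  assumes "smooth_on f S" "x \<in> S"
  obtains U g where "open U" "x \<in> U" "\<forall>k. Ck_on k g U" "\<forall>y\<in>U \<inter> S. g y = f y"
proof -
  have "\<exists>U g. open U \<and> x \<in> U \<and> (\<forall>k. Ck_on k g U) \<and> (\<forall>y\<in>U \<inter> S. g y = f y)"
    using assms unfolding smooth_on_def by (rule bspec)
  then obtain U g where
    *: "open U \<and> x \<in> U \<and> (\<forall>k. Ck_on k g U) \<and> (\<forall>y\<in>U \<inter> S. g y = f y)" by (elim exE)
  show ?thesis by (rule that[of U g]) (use * in simp_all)
qed

lemma smooth_on_subset:
  assumes "smooth_on f S" "T \<subseteq> S"
  shows "smooth_on f T"
  unfolding smooth_on_def
proof
  fix x assume "x \<in> T"
  then have "x \<in> S" using assms(2) by auto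
  with assms(1) obtain U g where "open U" "x \<in> U" "\<forall>k. Ck_on k g U" "\<forall>y\<in>U \<inter> S. g y = f y"
    by (rule smooth_onE)
  then show "\<exists>U g. open U \<and> x \<in> U \<and> (\<forall>k. Ck_on k g U) \<and> (\<forall>y\<in>U \<inter> T. g y = f y)"
    using assms(2) by (intro exI[of _ U] exI[of _ g]) auto
qed

lemma smooth_on_compose:
  assumes "smooth_on f S" "smooth_on g T" "f ` S \<subseteq> T"
  shows "smooth_on (\<lambda>x. g (f x)) S"
  unfolding smooth_on_def
proof
  fix x assume x: "x \<in> S"
  obtain U f' where U: "open U" "x \<in> U" "\<forall>k. Ck_on k f' U" "\<forall>y\<in>U \<inter> S. f' y = f y"
    using smooth_onE[OF assms(1) x] .
  have "f x \<in> T" using assms(3) x by auto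
  obtain W g' where W: "open W" "f x \<in> W" "\<forall>k. Ck_on k g' W" "\<forall>y\<in>W \<inter> T. g' y = g y"
    using smooth_onE[OF assms(2) \<open>f x \<in> T\<close>] .
  let ?U = "U \<inter> f' -` W"
  have o: "open ?U"
    using continuous_open_preimage[OF Ck_on_imp_continuous_on[OF U(3)[rule_format]] U(1) W(1)] .
  have "Ck_on k (\<lambda>x. g' (f' x)) ?U" for k
    by (rule Ck_on_compose[OF o W(1) Ck_on_subset[OF U(3)[rule_format]] W(3)[rule_format]]) auto
  moreover have "x \<in> ?U" using x U W by auto
  moreover have "\<forall>y\<in>?U \<inter> S. g' (f' y) = g (f y)" using U(4) W(4) assms(3) by auto
  ultimately show "\<exists>U h. open U \<and> x \<in> U \<and> (\<forall>k. Ck_on k h U) \<and> (\<forall>y\<in>U \<inter> S. h y = g (f y))"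
    using o by (intro exI[of _ ?U] exI[of _ "\<lambda>x. g' (f' x)"]) simp
qed

lemma smooth_on_imp_differentiable:
  assumes "smooth_on f S" "open S" "x \<in> S"
  shows "f differentiable (at x)"
proof -
  obtain U g where U: "open U" "x \<in> U" "\<forall>k. Ck_on k g U" "\<forall>y\<in>U \<inter> S. g y = f y"
    using smooth_onE[OF assms(1,3)] .
  have "Ck_on (Suc 0) g U" using U(3) by (rule spec)
  from Ck_on_has_derivative[OF this U(2)]
  have "(f has_derivative frechet_derivative g (at x)) (at x)"
    by (rule has_derivative_transform_within_open[of _ _ _ _ "U \<inter> S"]) (use U(1,2,4) assms(2,3) in auto)
  then show ?thesis by (rule differentiableI)
qed

lemma diffeomorphism_openI:
  assumes "open U" "open V" "\<And>k. Ck_on k \<phi> U" "\<And>k. Ck_on k \<psi> V"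
    and "\<And>x. x \<in> U \<Longrightarrow> \<phi> x \<in> V \<and> \<psi> (\<phi> x) = x"
    and "\<And>y. y \<in> V \<Longrightarrow> \<psi> y \<in> U \<and> \<phi> (\<psi> y) = y"
  shows "diffeomorphism U V \<phi> \<psi>"
proof -
  have "\<phi> ` U = V" "\<psi> ` V = U" using assms(5,6) by force+
  then show ?thesis
    unfolding diffeomorphism_def using assms by (simp add: smooth_on_open)
qed

section \<open>The mirror\<close>

definition mirror :: "(real^3) set" where
  "mirror = {x. x \<bullet> x + (x $ 3)\<^sup>2 = 2 \<and> \<bar>x $ 3\<bar> \<le> 3/5}"

text \<open>The constants \<open>3/5\<close> here and \<open>3/4\<close> in \<open>family_dir\<close> below are matched: the two points where a
  line with unit direction \<open>v\<close> and \<open>\<bar>v\<^sub>3\<bar> = 3/4\<close> through the focal circle crosses the ellipsoid have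
  distances from the focal point with product \<open>1 / (1 + v\<^sub>3\<^sup>2) = (4/5)\<^sup>2\<close>, so one of them lies
  below the level \<open>3/5\<close> and the other one above it.\<close>

lemma inner_3: "(x :: real^3) \<bullet> y = x $ 1 * y $ 1 + x $ 2 * y $ 2 + x $ 3 * y $ 3"
  by (simp add: inner_vec_def sum_3)

lemma norm_less_2:
  assumes "x \<bullet> x + (x $ 3)\<^sup>2 = 2"
  shows "norm (x :: real^3) < 2"
proof -
  have "(norm x)\<^sup>2 + (x $ 3)\<^sup>2 = 2" using assms by (simp add: dot_square_norm)
  then have "(norm x)\<^sup>2 < 4" using zero_le_power2[of "x $ 3"] by linarith
  then show ?thesis using power2_less_imp_less[of "norm x" 2] by simp
qed

lemma mirror_subset_ball: "mirror \<subseteq> ball 0 2"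
  using norm_less_2 by (auto simp: mirror_def)

lemma compact_mirror: "compact mirror"
proof -
  have "closed mirror"
    unfolding mirror_def
    by (intro closed_Collect_conj closed_Collect_eq closed_Collect_le continuous_intros)
  moreover have "bounded mirror"
    using bounded_ball mirror_subset_ball by (rule bounded_subset)
  ultimately show ?thesis by (simp add: compact_eq_bounded_closed)
qed

text \<open>A horizontal coordinate of fixed sign is traded for the defining function and recovered
  as a signed square root. The third chart coordinate is the depth below the edge
  \<open>\<kappa> * x $ 3 = 3/5\<close>; the choice of \<open>J\<close> decides whether the chart
  sees no edge or one, so interior and boundary charts come from the same construction.\<close>

lemma mirror_chart:
  fixes i j :: 3 and \<sigma> \<kappa> :: real and J :: "real set"
  assumes ij: "i = 1 \<and> j = 2 \<or> i = 2 \<and> j = 1"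
    and \<sigma>: "\<sigma> = 1 \<or> \<sigma> = -1" and \<kappa>: "\<kappa> = 1 \<or> \<kappa> = -1" and J: "open J"
  defines "\<phi> \<equiv> \<lambda>x :: real^3. vector [x \<bullet> x + (x $ 3)\<^sup>2 - 2, x $ j, 3/5 - \<kappa> * x $ 3] :: real^3"
    and "U \<equiv> {x :: real^3. 0 < \<sigma> * x $ i \<and> 3/5 - \<kappa> * x $ 3 \<in> J}"
    and "V \<equiv> {y :: real^3. 0 < 2 + y $ 1 - (y $ 2)\<^sup>2 - 2 * (3/5 - y $ 3)\<^sup>2 \<and> y $ 3 \<in> J}"
  obtains \<psi> where "open U" "open V" "diffeomorphism U V \<phi> \<psi>"
    "\<phi> ` (U \<inter> mirror) = {y \<in> V. y $ 1 = 0 \<and> \<bar>y $ 3 - 3/5\<bar> \<le> 3/5}"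
proof -
  define r where "r = (\<lambda>y :: real^3. 2 + y $ 1 - (y $ 2)\<^sup>2 - 2 * (3/5 - y $ 3)\<^sup>2)"
  define \<psi> where "\<psi> = (\<lambda>y. \<chi> k. if k = i then \<sigma> * sqrt (r y)
    else if k = j then y $ 2 else \<kappa> * (3/5 - y $ 3))"
  have [simp]: "\<sigma> * \<sigma> = 1" "\<kappa> * \<kappa> = 1" "\<sigma>\<^sup>2 = 1" "\<kappa>\<^sup>2 = 1" using \<sigma> \<kappa> by auto
  have [simp]: "\<sigma> * (\<sigma> * c) = c" "\<kappa> * (\<kappa> * c) = c" for c using \<sigma> \<kappa> by auto
  have sq: "x \<bullet> x = (x $ i)\<^sup>2 + (x $ j)\<^sup>2 + (x $ 3)\<^sup>2" for x :: "real^3"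
    using ij by (auto simp: inner_3 power2_eq_square)
  have [simp]: "i \<noteq> j" "i \<noteq> 3" "j \<noteq> 3" "j \<noteq> i" "3 \<noteq> i" "3 \<noteq> j" using ij by auto
  have k: "k = i \<or> k = j \<or> k = 3" for k using ij exhaust_3[of k] by auto
  have oU: "open U"
  proof -
    have "open ((\<lambda>x :: real^3. 3/5 - \<kappa> * x $ 3) -` J)"
      by (intro open_vimage J continuous_intros)
    moreover have "open {x :: real^3. 0 < \<sigma> * x $ i}"
      by (intro open_Collect_less continuous_intros)
    moreover have "U = {x. 0 < \<sigma> * x $ i} \<inter> (\<lambda>x. 3/5 - \<kappa> * x $ 3) -` J"
      by (auto simp: U_def)
    ultimately show ?thesis by auto
  qed
  have V: "V = {y. 0 < r y} \<inter> (\<lambda>y. y $ 3) -` J" by (auto simp: V_def r_def)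
  have oV: "open V"
    unfolding V r_def
    by (intro open_Int open_vimage J open_Collect_less continuous_intros)
  have c\<phi>: "Ck_on m \<phi> U" for m
  proof (rule Ck_on_vec[OF oU])
    fix k :: 3
    show "Ck_on m (\<lambda>x. \<phi> x $ k) U"
    proof -
      have "Ck_on m (\<lambda>x. x \<bullet> x + (x $ 3)\<^sup>2 - 2) U" "Ck_on m (\<lambda>x. x $ j) U"
        "Ck_on m (\<lambda>x. 3/5 - \<kappa> * x $ 3) U"
        by (intro oU Ck_on_diff Ck_on_add Ck_on_inner Ck_on_power Ck_on_mult
          Ck_on_nth Ck_on_const Ck_on_id)+
      then show ?thesis using exhaust_3[of k] by (auto simp: \<phi>_def)
    qed
  qed
  have cr: "Ck_on m (\<lambda>y. sqrt (r y)) V" for m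
    unfolding r_def
    by (intro Ck_on_sqrt oV Ck_on_diff Ck_on_add Ck_on_power Ck_on_mult
          Ck_on_nth Ck_on_const Ck_on_id) (simp add: V_def)
  have c\<psi>: "Ck_on m \<psi> V" for m
  proof (rule Ck_on_vec[OF oV])
    fix l :: 3
    show "Ck_on m (\<lambda>x. \<psi> x $ l) V"
    proof -
      have "Ck_on m (\<lambda>y. \<sigma> * sqrt (r y)) V" "Ck_on m (\<lambda>y. y $ 2) V"
        "Ck_on m (\<lambda>y. \<kappa> * (3/5 - y $ 3)) V"
        by (intro oV cr Ck_on_diff Ck_on_mult Ck_on_nth Ck_on_const Ck_on_id)+
      then show ?thesis using k[of l] by (auto simp: \<psi>_def)
    qed
  qed
  have \<phi>: "r (\<phi> x) = (x $ i)\<^sup>2" for x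
    unfolding r_def \<phi>_def by (simp add: sq power_mult_distrib)
  have 1: "\<phi> x \<in> V \<and> \<psi> (\<phi> x) = x" if x: "x \<in> U" for x
  proof -
    have "x $ i \<noteq> 0" using x by (auto simp: U_def)
    then have "0 < r (\<phi> x)" by (simp add: \<phi>)
    then have "\<phi> x \<in> V" using x by (auto simp: V U_def \<phi>_def)
    moreover have "\<sigma> * sqrt (r (\<phi> x)) = x $ i"
      using x \<sigma> by (auto simp: \<phi> U_def)
    then have "\<psi> (\<phi> x) $ l = x $ l" for l
      using k[of l] by (auto simp: \<psi>_def) (auto simp: \<phi>_def)
    then have "\<psi> (\<phi> x) = x" by (simp add: vec_eq_iff)
    ultimately show ?thesis by simp
  qed
  have 2: "\<psi> y \<in> U \<and> \<phi> (\<psi> y) = y" if y: "y \<in> V" for y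
  proof -
    have p: "0 < r y" using y by (simp add: V)
    have c: "\<psi> y $ i = \<sigma> * sqrt (r y)" "\<psi> y $ j = y $ 2" "\<psi> y $ 3 = \<kappa> * (3/5 - y $ 3)"
      by (auto simp: \<psi>_def)
    have "\<psi> y \<in> U" using y p by (auto simp: U_def c V)
    moreover have "\<psi> y \<bullet> \<psi> y + (\<psi> y $ 3)\<^sup>2 - 2 = y $ 1"
      using p unfolding sq c by (simp add: power_mult_distrib) (simp add: r_def)
    then have "\<phi> (\<psi> y) $ l = y $ l" for l
      using exhaust_3[of l] by (auto simp: \<phi>_def c)
    then have "\<phi> (\<psi> y) = y" by (simp add: vec_eq_iff)
    ultimately show ?thesis by simp
  qed
  have d: "diffeomorphism U V \<phi> \<psi>"
    by (rule diffeomorphism_openI[OF oU oV c\<phi> c\<psi> 1 2])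
  have m: "x \<in> mirror \<longleftrightarrow> \<phi> x $ 1 = 0 \<and> \<bar>\<phi> x $ 3 - 3/5\<bar> \<le> 3/5" for x
    using \<kappa> by (auto simp: mirror_def \<phi>_def)
  have "\<phi> ` (U \<inter> mirror) = {y \<in> V. y $ 1 = 0 \<and> \<bar>y $ 3 - 3/5\<bar> \<le> 3/5}"
  proof (intro set_eqI iffI)
    fix y assume "y \<in> \<phi> ` (U \<inter> mirror)"
    then show "y \<in> {y \<in> V. y $ 1 = 0 \<and> \<bar>y $ 3 - 3/5\<bar> \<le> 3/5}" using 1 m by blast
  next
    fix y assume y: "y \<in> {y \<in> V. y $ 1 = 0 \<and> \<bar>y $ 3 - 3/5\<bar> \<le> 3/5}"
    then have "\<psi> y \<in> U \<inter> mirror" using 2[of y] m[of "\<psi> y"] by auto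
    moreover have "\<phi> (\<psi> y) = y" using y 2 by blast
    ultimately show "y \<in> \<phi> ` (U \<inter> mirror)" by (metis imageI)
  qed
  with that[OF oU oV d] show ?thesis .
qed

lemma subspace_dim_coordinate_plane:
  "subspace {y :: real^3. y $ 1 = 0}" "dim {y :: real^3. y $ 1 = 0} = 2"
proof -
  have e: "{y :: real^3. y $ 1 = 0} = {y. axis 1 1 \<bullet> y = 0}"
    by (simp add: inner_axis')
  show "subspace {y :: real^3. y $ 1 = 0}" unfolding e by (rule subspace_hyperplane)
  show "dim {y :: real^3. y $ 1 = 0} = 2" unfolding e by (subst dim_hyperplane) auto
qed

text \<open>The height bound leaves at least \<open>2 - 2 * (3/5)^2 > 0\<close> for the sum of the
  two squared horizontal coordinates: the band avoids the poles.\<close>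

lemma mirror_horizontal:
  assumes "x \<in> mirror"
  obtains i j :: 3 and \<sigma> :: real where "i = 1 \<and> j = 2 \<or> i = 2 \<and> j = 1" "\<sigma> = 1 \<or> \<sigma> = -1" "0 < \<sigma> * x $ i"
proof -
  have "(x $ 3)\<^sup>2 \<le> (3/5)\<^sup>2" using assms by (simp add: mirror_def abs_le_square_iff[symmetric])
  then have "0 < (x $ 1)\<^sup>2 + (x $ 2)\<^sup>2"
    using assms by (simp add: mirror_def inner_3 power2_eq_square)
  then have "x $ 1 \<noteq> 0 \<or> x $ 2 \<noteq> 0" by auto
  then consider "0 < 1 * x $ 1" | "0 < (-1) * x $ 1" | "0 < 1 * x $ 2" | "0 < (-1) * x $ 2"
    by linarith
  then show ?thesis by cases (blast intro: that)+
qed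

lemma interior_chart_mirror:
  assumes x: "x \<in> mirror" "\<bar>x $ 3\<bar> < 3/5"
  shows "interior_chart_at 2 mirror x"
proof -
  obtain i j :: 3 and \<sigma> :: real where ij: "i = 1 \<and> j = 2 \<or> i = 2 \<and> j = 1" "\<sigma> = 1 \<or> \<sigma> = -1"
    and p: "0 < \<sigma> * x $ i"
    using mirror_horizontal[OF x(1)] .
  \<comment> \<open>Depth strictly between 0 and \<open>6/5\<close> means strictly between the two
    edges, so the height condition holds throughout the chart.\<close>
  let ?J = "{0<..<6/5::real}" and ?L = "{y :: real^3. y $ 1 = 0}"
  let ?\<phi> = "\<lambda>x :: real^3. vector [x \<bullet> x + (x $ 3)\<^sup>2 - 2, x $ j, 3/5 - 1 * x $ 3] :: real^3"
  let ?U = "{x :: real^3. 0 < \<sigma> * x $ i \<and> 3/5 - 1 * x $ 3 \<in> ?J}"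
  let ?V = "{y :: real^3. 0 < 2 + y $ 1 - (y $ 2)\<^sup>2 - 2 * (3/5 - y $ 3)\<^sup>2 \<and> y $ 3 \<in> ?J}"
  obtain \<psi> where c: "open ?U" "open ?V" "diffeomorphism ?U ?V ?\<phi> \<psi>"
    "?\<phi> ` (?U \<inter> mirror) = {y \<in> ?V. y $ 1 = 0 \<and> \<bar>y $ 3 - 3/5\<bar> \<le> 3/5}"
    using mirror_chart[OF ij, of 1 ?J] by auto
  have "{y \<in> ?V. y $ 1 = 0 \<and> \<bar>y $ 3 - 3/5\<bar> \<le> 3/5} = ?V \<inter> ?L"
    unfolding abs_le_iff by auto
  then have "?\<phi> ` (?U \<inter> mirror) = ?V \<inter> ?L" using c(4) by simp
  moreover have "x \<in> ?U" using p x(2) by (auto simp: abs_less_iff)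
  ultimately show ?thesis
    unfolding interior_chart_at_def using c(1-3) subspace_dim_coordinate_plane by blast
qed

lemma boundary_chart_mirror:
  assumes x: "x \<in> mirror" "\<bar>x $ 3\<bar> = 3/5"
  shows "boundary_chart_at 2 mirror x"
proof -
  obtain i j :: 3 and \<sigma> :: real where ij: "i = 1 \<and> j = 2 \<or> i = 2 \<and> j = 1" "\<sigma> = 1 \<or> \<sigma> = -1"
    and p: "0 < \<sigma> * x $ i"
    using mirror_horizontal[OF x(1)] .
  obtain \<kappa> :: real where \<kappa>: "\<kappa> = 1 \<or> \<kappa> = -1" "\<kappa> * x $ 3 = 3/5"
    using x(2) by (metis abs_if mult_1 mult_minus1)
  \<comment> \<open>Depth below \<open>3/5\<close> keeps only the half
    \<open>0 < \<kappa> * x $ 3\<close>, so the opposite edge is out of sight and the height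
    condition becomes nonnegative depth.\<close>
  let ?J = "{..<3/5::real}" and ?L = "{y :: real^3. y $ 1 = 0}" and ?e = "axis 3 1 :: real^3"
  let ?\<phi> = "\<lambda>x :: real^3. vector [x \<bullet> x + (x $ 3)\<^sup>2 - 2, x $ j, 3/5 - \<kappa> * x $ 3] :: real^3"
  let ?U = "{x :: real^3. 0 < \<sigma> * x $ i \<and> 3/5 - \<kappa> * x $ 3 \<in> ?J}"
  let ?V = "{y :: real^3. 0 < 2 + y $ 1 - (y $ 2)\<^sup>2 - 2 * (3/5 - y $ 3)\<^sup>2 \<and> y $ 3 \<in> ?J}"
  obtain \<psi> where c: "open ?U" "open ?V" "diffeomorphism ?U ?V ?\<phi> \<psi>"
    "?\<phi> ` (?U \<inter> mirror) = {y \<in> ?V. y $ 1 = 0 \<and> \<bar>y $ 3 - 3/5\<bar> \<le> 3/5}"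
    using mirror_chart[OF ij \<kappa>(1), of ?J] by auto
  have "{y \<in> ?V. y $ 1 = 0 \<and> \<bar>y $ 3 - 3/5\<bar> \<le> 3/5} = ?V \<inter> {y \<in> ?L. 0 \<le> ?e \<bullet> y}"
    unfolding abs_le_iff by (auto simp: inner_axis')
  then have "?\<phi> ` (?U \<inter> mirror) = ?V \<inter> {y \<in> ?L. 0 \<le> ?e \<bullet> y}" using c(4) by simp
  moreover have "x \<in> ?U" using p \<kappa> by auto
  moreover have "?e \<in> ?L" "?e \<noteq> 0" "?e \<bullet> ?\<phi> x = 0"
    using \<kappa> by (auto simp: inner_axis') (simp_all add: axis_def)
  ultimately show ?thesis
    unfolding boundary_chart_at_def using c(1-3) subspace_dim_coordinate_plane by blast
qed

lemma trap_mirror: "trap {mirror}"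
proof -
  have "interior_chart_at 2 mirror x \<or> boundary_chart_at 2 mirror x" if "x \<in> mirror" for x
  proof -
    have "\<bar>x $ 3\<bar> < 3/5 \<or> \<bar>x $ 3\<bar> = 3/5" using that by (auto simp: mirror_def)
    then show ?thesis using interior_chart_mirror boundary_chart_mirror that by blast
  qed
  then show ?thesis
    by (simp add: trap_def compact_mirror embedded_submanifold_with_boundary_def)
qed

section \<open>Billiards in the ellipsoid\<close>

definition quad :: "real^3 \<Rightarrow> real" where
  "quad x = x \<bullet> x + (x $ 3)\<^sup>2"

text \<open>Half of the gradient of \<open>quad\<close>.\<close>

definition conormal :: "real^3 \<Rightarrow> real^3" where
  "conormal x = x + (x $ 3) *\<^sub>R axis 3 1"

text \<open>Dividing by the squared length of the conormal, instead of using a unit normal, keeps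
  the later computations rational.\<close>

definition reflect :: "real^3 \<Rightarrow> real^3 \<Rightarrow> real^3" where
  "reflect x v = v - (2 * (v \<bullet> conormal x) / (conormal x \<bullet> conormal x)) *\<^sub>R conormal x"

lemma mirror_iff: "x \<in> mirror \<longleftrightarrow> quad x = 2 \<and> \<bar>x $ 3\<bar> \<le> 3/5"
  by (simp add: mirror_def quad_def)

lemma inner_conormal: "v \<bullet> conormal x = v \<bullet> x + v $ 3 * x $ 3"
  by (simp add: conormal_def inner_add_right inner_axis)

lemma conormal_nth_3: "conormal x $ 3 = 2 * x $ 3"
  by (simp add: conormal_def axis_def)

lemma conormal_inner_self: "quad x = 2 \<Longrightarrow> conormal x \<bullet> conormal x = 2 * (1 + (x $ 3)\<^sup>2)"
  unfolding inner_conormal conormal_nth_3 inner_commute[of "conormal x" x]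
  by (simp add: inner_conormal quad_def power2_eq_square)

lemma quad_line: "quad (x + t *\<^sub>R v) = quad x + 2 * t * (v \<bullet> conormal x) + t\<^sup>2 * quad v"
  unfolding quad_def inner_conormal
  by (simp add: inner_add_left inner_add_right inner_commute[of x v] power2_eq_square algebra_simps)

text \<open>The two equations differ by a multiple of \<open>t\<close>, and cancelling it leaves a
  linear equation. For \<open>quad v > 0\<close> a line through a point of the ellipsoid thus has at
  most one further crossing.\<close>

lemma quad_chord:
  assumes "quad x = 2" "quad (x + t *\<^sub>R v) = 2" "t \<noteq> 0"
  shows "2 * (v \<bullet> conormal x) + t * quad v = 0"
proof -
  have "t * (2 * (v \<bullet> conormal x) + t * quad v) = 0"
    using assms(1,2) unfolding quad_line by (simp add: power2_eq_square algebra_simps)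
  then show ?thesis using assms(3) by simp
qed

lemma norm_reflect:
  assumes "quad x = 2"
  shows "norm (reflect x v) = norm v"
proof -
  let ?N = "conormal x"
  have p: "?N \<bullet> ?N \<noteq> 0"
    using zero_le_power2[of "x $ 3"] by (simp add: conormal_inner_self[OF assms]) (smt (verit) zero_le_power2)
  have "reflect x v \<bullet> reflect x v = v \<bullet> v"
    using p unfolding reflect_def
    by (simp add: inner_diff_left inner_diff_right inner_commute[of ?N v] field_simps power2_eq_square)
  then show ?thesis by (simp add: norm_eq_sqrt_inner)
qed

text \<open>Differentiate the equation of the ellipsoid along a curve in the band. This yields the
  unit normal of the reflection law and, by contraposition, rules out tangential collisions.\<close>

lemma tangent_space_mirror:
  assumes "v \<in> tangent_space mirror x"
  shows "v \<bullet> conormal x = 0"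
proof -
  obtain c \<epsilon> where c: "0 < \<epsilon>" "c ` {-\<epsilon><..<\<epsilon>} \<subseteq> mirror" "c 0 = x" "(c has_vector_derivative v) (at 0)"
    using assms unfolding tangent_space_def by blast
  have d3: "((\<lambda>t. c t $ 3) has_vector_derivative v $ 3) (at 0)"
    by (rule bounded_linear.has_vector_derivative[OF bounded_linear_vec_nth c(4)])
  have "((\<lambda>t. c t \<bullet> c t + c t $ 3 * c t $ 3) has_vector_derivative
      (c 0 \<bullet> v + v \<bullet> c 0) + (c 0 $ 3 * v $ 3 + v $ 3 * c 0 $ 3)) (at 0)"
    by (intro has_vector_derivative_add bounded_bilinear.has_vector_derivative[OF bounded_bilinear_inner]
        bounded_bilinear.has_vector_derivative[OF bounded_bilinear_mult] c(4) d3)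
  moreover have "((\<lambda>t. c t \<bullet> c t + c t $ 3 * c t $ 3) has_vector_derivative 0) (at 0)"
  proof (rule has_vector_derivative_transform_within_open[of "\<lambda>t. 2" _ _ "{-\<epsilon><..<\<epsilon>}"])
    fix t assume "t \<in> {-\<epsilon><..<\<epsilon>}"
    then have "c t \<in> mirror" using c(2) by blast
    then show "2 = c t \<bullet> c t + c t $ 3 * c t $ 3" by (simp add: mirror_def power2_eq_square)
  qed (use c(1) in auto)
  ultimately have "(c 0 \<bullet> v + v \<bullet> c 0) + (c 0 $ 3 * v $ 3 + v $ 3 * c 0 $ 3) = 0"
    by (rule vector_derivative_unique_at)
  then show ?thesis by (simp add: inner_conormal c(3) inner_commute[of x v] mult.commute[of "x $ 3"])
qed

lemma unit_normal_at_mirror: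
  assumes "quad x = 2"
  obtains n where "unit_normal_at mirror x n" "\<And>v. reflect x v = v - (2 * (v \<bullet> n)) *\<^sub>R n"
proof
  let ?N = "conormal x"
  let ?n = "(1 / norm ?N) *\<^sub>R ?N"
  have "?N \<bullet> ?N \<noteq> 0"
    using zero_le_power2[of "x $ 3"] by (simp add: conormal_inner_self[OF assms]) (smt (verit) zero_le_power2)
  then have p: "norm ?N \<noteq> 0" by auto
  have "?n \<bullet> v = 0" if "v \<in> tangent_space mirror x" for v
    using tangent_space_mirror[OF that] by (simp add: inner_commute)
  then show "unit_normal_at mirror x ?n" using p by (simp add: unit_normal_at_def)
  show "reflect x v = v - (2 * (v \<bullet> ?n)) *\<^sub>R ?n" for v
    by (simp add: reflect_def dot_square_norm power2_eq_square)
qed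

section \<open>From sequences of hits to nonsingular trajectories\<close>

text \<open>\<open>W n\<close> is the velocity arriving at \<open>X n\<close>, so the segment
  leaving \<open>X n\<close> has velocity \<open>W (Suc n)\<close> and the incoming ray has
  \<open>W 0\<close>.\<close>

lemma polygonal_path:
  fixes T :: "nat \<Rightarrow> real" and X W :: "nat \<Rightarrow> 'a::real_vector"
  assumes gap: "\<And>n. T n + 1 \<le> T (Suc n)"
    and step: "\<And>n. X (Suc n) = X n + (T (Suc n) - T n) *\<^sub>R W (Suc n)"
  shows "\<exists>\<gamma>. (\<forall>t\<le>T 0. \<gamma> t = X 0 + (t - T 0) *\<^sub>R W 0) \<and>
    (\<forall>n t. T n \<le> t \<longrightarrow> t \<le> T (Suc n) \<longrightarrow> \<gamma> t = X n + (t - T n) *\<^sub>R W (Suc n))"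
proof -
  have mono: "T m \<le> T n" if "m \<le> n" for m n
    using that by (induction n rule: dec_induct) (use gap in \<open>auto intro: order_trans[of _ "T _"] simp: add_increasing2\<close>, smt (verit) gap)
  \<comment> \<open>Each segment is anchored at its end point, the first hit not before
    \<open>t\<close>; the incoming half-line then needs no separate clause.\<close>
  define \<gamma> where "\<gamma> t = (let n = LEAST n. t \<le> T n in X n + (t - T n) *\<^sub>R W n)" for t
  have "\<gamma> t = X 0 + (t - T 0) *\<^sub>R W 0" if "t \<le> T 0" for t
  proof -
    have "(LEAST n. t \<le> T n) = 0" using that by (intro Least_equality) auto
    then show ?thesis by (simp add: \<gamma>_def)
  qed
  moreover have "\<gamma> t = X n + (t - T n) *\<^sub>R W (Suc n)" if "T n \<le> t" "t \<le> T (Suc n)" for n t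
  proof (cases "t = T n")
    case True
    have "n \<le> m" if "T n \<le> T m" for m
      using mono[of "Suc m" n] gap[of m] that by (cases "n \<le> m") auto
    then have "(LEAST m. t \<le> T m) = n" using True by (intro Least_equality) auto
    then show ?thesis by (simp add: \<gamma>_def True)
  next
    case False
    have "Suc n \<le> m" if "t \<le> T m" for m
      using mono[of m n] False \<open>T n \<le> t\<close> that by (cases "Suc n \<le> m") auto
    then have "(LEAST m. t \<le> T m) = Suc n" using that(2) by (intro Least_equality) auto
    then show ?thesis by (simp add: \<gamma>_def step algebra_simps)
  qed
  ultimately show ?thesis by (intro exI[of _ \<gamma>]) simp
qed

text \<open>Reduces the billiard to sequences of hit times, hit points and velocities. In
  \<open>pre\<close> and \<open>ball\<close> time is counted from the first hit. \<open>pre\<close>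
  speaks of the band and not of the ellipsoid, because the intended ray crosses the ellipsoid
  through an opening before that hit.\<close>

lemma polygonal_billiard:
  fixes T :: "nat \<Rightarrow> real" and X W :: "nat \<Rightarrow> real^3"
  assumes gap: "\<And>n. T n + 1 \<le> T (Suc n)"
    and step: "\<And>n. X (Suc n) = X n + (T (Suc n) - T n) *\<^sub>R W (Suc n)"
    and X: "\<And>n. quad (X n) = 2" "\<And>n. \<bar>X n $ 3\<bar> < 3/5"
    and W: "\<And>n. norm (W n) = 1" "\<And>n. W (Suc n) = reflect (X n) (W n)" "\<And>n. 0 < W n \<bullet> conormal (X n)"
    and pre: "\<And>t. t < 0 \<Longrightarrow> X 0 + t *\<^sub>R W 0 \<notin> mirror"
    and ball: "\<And>t. t \<le> 0 \<Longrightarrow> X 0 + t *\<^sub>R W 0 \<in> cball 0 2 \<longleftrightarrow> r \<le> t" "r \<le> 0"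
    and line: "\<And>t. snd l + t *\<^sub>R fst l = X 0 + (t - T 0) *\<^sub>R W 0"
  shows "\<exists>\<gamma>. billiard_trajectory {mirror} l \<gamma> \<and> nonsingular {mirror} \<gamma> \<and>
    (\<exists>t\<^sub>0. \<forall>t. \<gamma> t \<in> cball 0 2 \<longleftrightarrow> t\<^sub>0 \<le> t)"
proof -
  obtain \<gamma> where \<gamma>: "\<forall>t\<le>T 0. \<gamma> t = X 0 + (t - T 0) *\<^sub>R W 0"
    "\<forall>n t. T n \<le> t \<longrightarrow> t \<le> T (Suc n) \<longrightarrow> \<gamma> t = X n + (t - T n) *\<^sub>R W (Suc n)"
    using polygonal_path[of T X W, OF gap step] by blast
  have \<gamma>0: "\<gamma> t = X 0 + (t - T 0) *\<^sub>R W 0" if "t \<le> T 0" for t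
    using \<gamma>(1) that by blast
  have \<gamma>1: "\<gamma> t = X n + (t - T n) *\<^sub>R W (Suc n)" if "T n \<le> t" "t \<le> T (Suc n)" for n t
    using \<gamma>(2) that by blast
  \<comment> \<open>Unit gaps drive the hit times to infinity: every time after the first hit lies
    on some segment, and bounded intervals contain finitely many hits.\<close>
  have lower: "T 0 + real n \<le> T n" for n
    by (induction n) (use gap in \<open>auto intro: order_trans\<close>, smt (verit) gap)
  have piece: "\<exists>n. T n < t \<and> t \<le> T (Suc n)" if t: "T 0 < t" for t
  proof -
    obtain k where "t - T 0 \<le> real k" using real_arch_simple by blast
    then have "t \<le> T k" using lower[of k] by linarith
    then have ex: "\<exists>n. t \<le> T n" by blast
    define m where "m = (LEAST n. t \<le> T n)"
    have m: "t \<le> T m" unfolding m_def using ex by (rule LeastI_ex)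
    then have "m \<noteq> 0" using t by (metis not_le)
    then obtain n where n: "m = Suc n" using not0_implies_Suc by blast
    have "\<not> t \<le> T n" using not_less_Least[of n "\<lambda>n. t \<le> T n"] n m_def by auto
    then show ?thesis using m n by (intro exI[of _ n]) auto
  qed
  have at: "\<gamma> (T n) = X n" for n
    using \<gamma>1[of n "T n"] gap[of n] by simp
  have Xm: "X n \<in> mirror" for n
    using X[of n] by (simp add: mirror_iff)
  have left: "\<gamma> t = X n + (t - T n) *\<^sub>R W n" if "T n - 1 < t" "t \<le> T n" for n t
  proof (cases n)
    case 0
    then show ?thesis using \<gamma>0 that by simp
  next
    case (Suc m)
    then have "\<gamma> t = X m + (t - T m) *\<^sub>R W n" using \<gamma>1[of m t] gap[of m] that by simp
    then show ?thesis unfolding Suc by (simp add: step algebra_simps)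
  qed
  have quadW: "0 < quad (W n)" for n
    using W(1)[of n] zero_le_power2[of "W n $ 3"] by (simp add: quad_def dot_square_norm add_pos_nonneg)
  \<comment> \<open>On the line leaving \<open>X n\<close> the only other point of the ellipsoid is
    \<open>X (Suc n)\<close>: \<open>quad_chord\<close> forces the two parameters to agree.\<close>
  have hit: "\<exists>n. t = T n" if t: "\<gamma> t \<in> mirror" for t
  proof (cases "t \<le> T 0")
    case True
    then show ?thesis using \<gamma>0[of t] pre[of "t - T 0"] t by (cases "t = T 0") auto
  next
    case False
    then obtain n where n: "T n < t" "t \<le> T (Suc n)" using piece by force
    let ?s = "t - T n" and ?S = "T (Suc n) - T n"
    let ?w = "W (Suc n)"
    have S: "0 < ?s" "0 < ?S" using n by auto
    have "quad (X n + ?s *\<^sub>R ?w) = 2"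
      using t \<gamma>1[of n t] n by (simp add: mirror_iff)
    from quad_chord[OF X(1) this] S
    have "2 * (?w \<bullet> conormal (X n)) + ?s * quad ?w = 0" by simp
    moreover have "quad (X n + ?S *\<^sub>R ?w) = 2"
      using X(1)[of "Suc n"] by (simp add: step)
    from quad_chord[OF X(1) this] S
    have "2 * (?w \<bullet> conormal (X n)) + ?S * quad ?w = 0" by simp
    ultimately have "?s * quad ?w = ?S * quad ?w" by linarith
    then have "?s = ?S" using quadW[of "Suc n"] by simp
    then show ?thesis by auto
  qed
  have dleft: "(\<gamma> has_vector_derivative W n) (at_left (T n))" for n
  proof -
    have "((\<lambda>t. X n + (t - T n) *\<^sub>R W n) has_vector_derivative W n) (at (T n) within {..T n})"
      by (auto intro!: derivative_eq_intros)
    then have "(\<gamma> has_vector_derivative W n) (at (T n) within {..T n})"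
      by (rule has_vector_derivative_transform_within[where d = 1])
         (auto simp: dist_real_def intro!: left[symmetric])
    then show ?thesis by (rule has_vector_derivative_within_subset) auto
  qed
  have dright: "(\<gamma> has_vector_derivative W (Suc n)) (at_right (T n))" for n
  proof -
    have "((\<lambda>t. X n + (t - T n) *\<^sub>R W (Suc n)) has_vector_derivative W (Suc n)) (at (T n) within {T n..})"
      by (auto intro!: derivative_eq_intros)
    then have "(\<gamma> has_vector_derivative W (Suc n)) (at (T n) within {T n..})"
    proof (rule has_vector_derivative_transform_within[where d = 1])
      fix t assume "t \<in> {T n..}" "dist t (T n) < 1"
      then show "X n + (t - T n) *\<^sub>R W (Suc n) = \<gamma> t"
        using \<gamma>1[of n t] gap[of n] by (auto simp: dist_real_def)
    qed auto
    then show ?thesis by (rule has_vector_derivative_within_subset) auto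
  qed
  have "billiard_trajectory {mirror} l \<gamma>"
    unfolding billiard_trajectory_def
  proof (intro conjI allI impI ballI)
    show "\<exists>t\<^sub>0. \<forall>t\<le>t\<^sub>0. \<gamma> t = snd l + t *\<^sub>R fst l"
      using \<gamma>0 line by metis
  next
    fix a b assume ab: "a < b \<and> (\<forall>t\<in>{a<..<b}. \<gamma> t \<notin> \<Union>{mirror})"
    \<comment> \<open>A collision-free interval has no hit time in its interior, so it lies on a
      single straight piece.\<close>
    have nT: "\<not> (a < T n \<and> T n < b)" for n
    proof
      assume "a < T n \<and> T n < b"
      then have "\<gamma> (T n) \<notin> \<Union>{mirror}" using ab by simp
      then show False using at[of n] Xm[of n] by simp
    qed
    show "\<exists>w. norm w = 1 \<and> (\<forall>t\<in>{a..b}. \<gamma> t = \<gamma> a + (t - a) *\<^sub>R w)"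
    proof (cases "b \<le> T 0")
      case True
      have "\<gamma> t = \<gamma> a + (t - a) *\<^sub>R W 0" if "t \<in> {a..b}" for t
        using \<gamma>0[of t] \<gamma>0[of a] that True by (simp add: scaleR_left_diff_distrib)
      then show ?thesis using W(1) by blast
    next
      case False
      then obtain n where n: "T n < b" "b \<le> T (Suc n)" using piece by force
      then have "T n \<le> a" using nT[of n] by auto
      then have "\<gamma> t = \<gamma> a + (t - a) *\<^sub>R W (Suc n)" if "t \<in> {a..b}" for t
        using \<gamma>1[of n t] \<gamma>1[of n a] n that by (simp add: scaleR_left_diff_distrib)
      then show ?thesis using W(1) by blast
    qed
  next
    fix t M assume M: "M \<in> {mirror}" "\<gamma> t \<in> manifold_interior 2 M"
    then have "\<gamma> t \<in> mirror" by (simp add: manifold_interior_def)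
    then obtain n where n: "t = T n" using hit by blast
    obtain \<nu> where \<nu>: "unit_normal_at mirror (X n) \<nu>"
      "\<And>v. reflect (X n) v = v - (2 * (v \<bullet> \<nu>)) *\<^sub>R \<nu>"
      using unit_normal_at_mirror[OF X(1)] by blast
    show "\<exists>v w n. (\<gamma> has_vector_derivative v) (at_left t) \<and>
           (\<gamma> has_vector_derivative w) (at_right t) \<and>
           unit_normal_at M (\<gamma> t) n \<and> w = v - (2 * (v \<bullet> n)) *\<^sub>R n"
      using dleft[of n] dright[of n] \<nu>(1) \<nu>(2)[of "W n"] W(2)[of n] M(1) at[of n]
      by (intro exI[of _ "W n"] exI[of _ "W (Suc n)"] exI[of _ \<nu>]) (simp add: n)
  qed
  moreover have "nonsingular {mirror} \<gamma>"
    unfolding nonsingular_def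
  proof (intro conjI allI impI ballI)
    fix t M v assume M: "M \<in> {mirror}" "\<gamma> t \<in> M \<and> (\<gamma> has_vector_derivative v) (at_left t)"
    then obtain n where n: "t = T n" using hit by blast
    have "v = W n"
      using vector_derivative_unique_within[OF _ conjunct2[OF M(2)], of "W n"] dleft[of n]
        trivial_limit_at_left_real[of "T n"] by (simp add: n trivial_limit_def)
    then show "v \<notin> tangent_space M (\<gamma> t)"
      using tangent_space_mirror[of "W n" "X n"] W(3)[of n] M(1) at[of n] n by auto
  next
    fix t M assume M: "M \<in> {mirror}"
    show "\<gamma> t \<notin> manifold_boundary 2 M"
    proof
      assume b: "\<gamma> t \<in> manifold_boundary 2 M"
      then obtain n where "t = T n" using hit M by (auto simp: manifold_boundary_def)
      then have "interior_chart_at 2 mirror (\<gamma> t)"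
        using interior_chart_mirror[OF Xm X(2)] at by simp
      then show False using b M by (simp add: manifold_boundary_def manifold_interior_def)
    qed
  next
    fix a b
    have "{t \<in> {a..b}. \<gamma> t \<in> \<Union>{mirror}} \<subseteq> T ` {..nat \<lceil>b - T 0\<rceil>}"
    proof
      fix t assume "t \<in> {t \<in> {a..b}. \<gamma> t \<in> \<Union>{mirror}}"
      then have t: "t \<le> b" "\<gamma> t \<in> mirror" by auto
      then obtain n where n: "t = T n" using hit by blast
      then have "real n \<le> b - T 0" using lower[of n] t by linarith
      then have "n \<le> nat \<lceil>b - T 0\<rceil>" by linarith
      then show "t \<in> T ` {..nat \<lceil>b - T 0\<rceil>}" using n by auto
    qed
    then show "finite {t \<in> {a..b}. \<gamma> t \<in> \<Union>{mirror}}" by (rule finite_subset) simp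
  qed auto
  moreover have "\<gamma> t \<in> cball 0 2 \<longleftrightarrow> T 0 + r \<le> t" for t
  proof (cases "t \<le> T 0")
    case True
    then show ?thesis using \<gamma>0[of t] ball(1)[of "t - T 0"] by auto
  next
    case False
    then obtain n where n: "T n < t" "t \<le> T (Suc n)" using piece by force
    have Xc: "X m \<in> cball 0 2" for m
      using norm_less_2[of "X m"] X(1)[of m] by (simp add: quad_def)
    \<comment> \<open>From the first hit on the path consists of chords, and the ball is convex, so
      it is enough that the hit points lie in it.\<close>
    obtain u where u: "0 \<le> u" "u \<le> 1" "t - T n = u * (T (Suc n) - T n)"
      using that[of "(t - T n) / (T (Suc n) - T n)"] n by auto
    have "\<gamma> t = X n + (u * (T (Suc n) - T n)) *\<^sub>R W (Suc n)"
      unfolding u(3)[symmetric] using \<gamma>1[of n t] n by simp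
    also have "\<dots> = (1 - u) *\<^sub>R X n + u *\<^sub>R X (Suc n)"
      by (simp only: step scaleR_add_right scaleR_scaleR) (simp add: scaleR_left_diff_distrib[of 1 u])
    also have "\<dots> \<in> cball 0 2"
      by (rule convexD_alt[OF convex_cball Xc Xc u(1,2)])
    finally show ?thesis using False ball(2) by auto
  qed
  then have "\<exists>t\<^sub>0. \<forall>t. \<gamma> t \<in> cball 0 2 \<longleftrightarrow> t\<^sub>0 \<le> t" by blast
  ultimately show ?thesis by blast
qed

section \<open>The return map on rays through the focal circle\<close>

definition outgoing :: "real^3 \<Rightarrow> real^3 \<Rightarrow> bool" where
  "outgoing f v \<longleftrightarrow> f $ 3 = 0 \<and> f \<bullet> f = 1 \<and> v \<bullet> v = 1 \<and> v $ 3 \<noteq> 0 \<and> 0 < f \<bullet> v"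

text \<open>A ray leaving a point \<open>f\<close> of the focal circle outwards hits the ellipsoid at height \<open>z\<close> after
  the time \<open>t < 1\<close> and then, by the focal property, meets the focal circle again, where it is
  outgoing once more.  The two distances from the hit point to the focal circle have product
  \<open>1 + z\<^sup>2\<close>, so the second one exceeds \<open>1\<close>; hence \<open>\<bar>z\<bar>\<close> decreases from each hit to the next.\<close>

definition hit_time :: "real^3 \<Rightarrow> real^3 \<Rightarrow> real" where
  "hit_time f v = (sqrt ((f \<bullet> v)\<^sup>2 + (1 + (v $ 3)\<^sup>2)) - f \<bullet> v) / (1 + (v $ 3)\<^sup>2)"

definition hit_point :: "real^3 \<Rightarrow> real^3 \<Rightarrow> real^3" where
  "hit_point f v = f + hit_time f v *\<^sub>R v"

definition return_time :: "real^3 \<Rightarrow> real^3 \<Rightarrow> real" where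
  "return_time f v = (1 + (hit_point f v $ 3)\<^sup>2) / hit_time f v"

definition next_focal :: "real^3 \<Rightarrow> real^3 \<Rightarrow> real^3" where
  "next_focal f v = hit_point f v + return_time f v *\<^sub>R reflect (hit_point f v) v"

text \<open>The formula is the positive root of the quadratic equation in the last claim. The linear
  term is positive and the leading coefficient is at least 1, which forces the root below 1.\<close>

lemma hit_time:
  assumes "outgoing f v"
  shows "0 < hit_time f v" "hit_time f v < 1"
    "(1 + (v $ 3)\<^sup>2) * (hit_time f v)\<^sup>2 + 2 * (f \<bullet> v) * hit_time f v = 1"
proof -
  let ?D = "f \<bullet> v" and ?k = "1 + (v $ 3)\<^sup>2" and ?t = "hit_time f v"
  let ?r = "sqrt (?D\<^sup>2 + ?k)"
  have k: "1 \<le> ?k" "0 < ?k" by (simp_all add: add_pos_nonneg)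
  have D: "0 < ?D" using assms by (simp add: outgoing_def)
  have r: "?r\<^sup>2 = ?D\<^sup>2 + ?k" using k by (intro real_sqrt_pow2) (simp add: add_nonneg_nonneg)
  have "?D < ?r" using k by (intro real_less_rsqrt) simp
  then show t: "0 < ?t" using k unfolding hit_time_def by (intro divide_pos_pos) auto
  have kt: "?k * ?t = ?r - ?D" using k by (simp add: hit_time_def)
  have "?k * (?k * ?t\<^sup>2 + 2 * ?D * ?t) = (?k * ?t)\<^sup>2 + 2 * ?D * (?k * ?t)"
    by algebra
  also have "\<dots> = ?r\<^sup>2 - ?D\<^sup>2" unfolding kt by algebra
  also have "\<dots> = ?k * 1" using r by simp
  finally show e: "?k * ?t\<^sup>2 + 2 * ?D * ?t = 1" using k(2) by (metis mult_cancel_left less_irrefl)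
  have "0 < 2 * ?D * ?t" using D t by simp
  moreover have "?t\<^sup>2 \<le> ?k * ?t\<^sup>2" using mult_right_mono[OF k(1), of "?t\<^sup>2"] by simp
  ultimately have "?t\<^sup>2 < 1\<^sup>2" using e by simp
  then show "?t < 1" by (rule power2_less_imp_less) simp
qed

lemma quad_focal_line:
  assumes "outgoing f v"
  shows "quad (f + t *\<^sub>R v) = 1 + 2 * (f \<bullet> v) * t + (1 + (v $ 3)\<^sup>2) * t\<^sup>2"
  using assms unfolding quad_line
  by (simp add: outgoing_def quad_def inner_conormal inner_commute[of v f] algebra_simps)

lemma quad_hit_point: "outgoing f v \<Longrightarrow> quad (hit_point f v) = 2"
  using hit_time(3)[of f v] by (simp add: hit_point_def quad_focal_line)

lemma hit_point_nth_3: "outgoing f v \<Longrightarrow> hit_point f v $ 3 = hit_time f v * v $ 3"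
  by (simp add: hit_point_def outgoing_def)

text \<open>By the choice of \<open>return_time\<close> the product \<open>t * t'\<close> equals
  \<open>s\<close>. After clearing powers of \<open>t\<close>, the focal property becomes polynomial
  identities modulo the quadratic equation for \<open>t\<close>.\<close>

lemma outgoing_next:
  fixes f v :: "real^3"
  defines "x \<equiv> hit_point f v" and "t' \<equiv> return_time f v"
  defines "w \<equiv> reflect x v" and "f' \<equiv> next_focal f v"
  assumes o: "outgoing f v"
  shows "0 < v \<bullet> conormal x" "1 < t'" "outgoing f' w" "x $ 3 = - (t' * w $ 3)"
proof -
  define t where "t = hit_time f v"
  define c where "c = v $ 3"
  define D where "D = f \<bullet> v"
  define A where "A = v \<bullet> conormal x"
  have t: "0 < t" "t < 1" "(1 + c\<^sup>2) * t\<^sup>2 + 2 * D * t = 1"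
    using hit_time[OF o] by (simp_all add: t_def c_def D_def)
  have D: "0 < D" "c \<noteq> 0" "v \<bullet> v = 1" "f \<bullet> f = 1" "f $ 3 = 0"
    using o by (simp_all add: D_def c_def outgoing_def)
  have x3: "x $ 3 = t * c" using hit_point_nth_3[OF o] by (simp add: x_def t_def c_def)
  have q: "quad x = 2" unfolding x_def by (rule quad_hit_point[OF o])
  have xx: "x \<bullet> x = 2 - (t * c)\<^sup>2" using q by (simp add: quad_def x3)
  have vx: "v \<bullet> x = D + t"
    using D(3) by (simp add: x_def hit_point_def D_def t_def inner_add_right inner_commute)
  have A: "A = D + t + t * c\<^sup>2"
    by (simp add: A_def inner_conormal vx x3 c_def power2_eq_square)
  have "0 \<le> t * c\<^sup>2" using t(1) by simp
  then show "0 < v \<bullet> conormal x" using A D(1) t(1) unfolding A_def by linarith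
  define s where "s = 1 + (t * c)\<^sup>2"
  have s: "1 \<le> s" by (simp add: s_def)
  have t': "t' = s / t" by (simp add: t'_def return_time_def x_def[symmetric] x3 t_def[symmetric] s_def)
  show t'1: "1 < t'" using s t by (simp add: t')
  have w: "w = v - (A / s) *\<^sub>R conormal x"
    unfolding w_def reflect_def conormal_inner_self[OF q] A_def x3 s_def mult_divide_mult_cancel_left_if
    by simp
  have w3: "w $ 3 = c - A / s * (2 * (t * c))"
    by (simp add: w conormal_nth_3 x3 c_def)
  have ww: "w \<bullet> w = 1" using norm_reflect[OF q, of v] D(3) by (simp add: w_def norm_eq_sqrt_inner)
  have xN: "x \<bullet> conormal x = 2" using q by (simp add: inner_conormal quad_def power2_eq_square)
  have xw: "x \<bullet> w = D + t - A / s * 2"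
    by (simp add: w inner_diff_right xN inner_commute[of x v] vx)
  have f': "f' = x + t' *\<^sub>R w" by (simp add: f'_def next_focal_def x_def t'_def w_def)
  \<comment> \<open>The height at the candidate focal point is a multiple of
    \<open>t^2 + s - 2 * t * A\<close>, which vanishes by the quadratic equation for
    \<open>t\<close>.\<close>
  have "t * (t * c + t' * w $ 3) = c * (t\<^sup>2 + s - 2 * t * A)"
    using t(1) s unfolding t' w3 by (simp add: field_simps power2_eq_square)
  also have "t\<^sup>2 + s - 2 * t * A = 0"
    using t(3) unfolding A s_def by (simp add: power2_eq_square algebra_simps)
  finally have z: "t * c + t' * w $ 3 = 0" using t(1) by simp
  then show "x $ 3 = - (t' * w $ 3)" by (simp add: x3)
  have f'3: "f' $ 3 = 0" using z by (simp add: f' x3)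
  have w0: "w $ 3 \<noteq> 0" using z t(1) D(2) by auto
  have ff: "f' \<bullet> f' = x \<bullet> x + 2 * t' * (x \<bullet> w) + t'\<^sup>2"
    using ww by (simp add: f' inner_add_left inner_add_right inner_commute[of w x] power2_eq_square algebra_simps)
  have "t\<^sup>2 * (f' \<bullet> f') = 2 * t\<^sup>2 - t\<^sup>2 * (t * c)\<^sup>2 + s * (2 * t * D + 2 * t\<^sup>2) - 4 * t * A + s\<^sup>2"
    using t(1) s unfolding ff xx xw t' by (simp add: field_simps power2_eq_square)
  also have "2 * t * D = 1 - (1 + c\<^sup>2) * t\<^sup>2" using t(3) by (simp add: algebra_simps)
  also have "4 * t * A = 2 * (2 * t * D) + 4 * (1 + c\<^sup>2) * t\<^sup>2"
    unfolding A by (simp add: power2_eq_square algebra_simps)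
  \<comment> \<open>Expanding \<open>A\<close> brought \<open>2 * t * D\<close> back; this second
    substitution removes \<open>D\<close> for good.\<close>
  also have "2 * t * D = 1 - (1 + c\<^sup>2) * t\<^sup>2" using t(3) by (simp add: algebra_simps)
  also have "2 * t\<^sup>2 - t\<^sup>2 * (t * c)\<^sup>2 + s * (1 - (1 + c\<^sup>2) * t\<^sup>2 + 2 * t\<^sup>2) -
      (2 * (1 - (1 + c\<^sup>2) * t\<^sup>2) + 4 * (1 + c\<^sup>2) * t\<^sup>2) + s\<^sup>2 = t\<^sup>2"
    unfolding s_def by (simp add: power2_eq_square algebra_simps)
  finally have f'1: "f' \<bullet> f' = 1" using t(1) by simp
  \<comment> \<open>The sign of \<open>f' \<bullet> w\<close> is read off from the lengths of
    \<open>x\<close> and \<open>f'\<close>: multiplied by \<open>2 * t'\<close> it is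
    \<open>t'^2 - 1 + (t * c)^2\<close>, positive because \<open>t'\<close> exceeds 1.\<close>
  have "f' \<bullet> w = x \<bullet> w + t'" using ww by (simp add: f' inner_add_left)
  then have "2 * t' * (f' \<bullet> w) = 2 * t' * (x \<bullet> w) + 2 * t'\<^sup>2" by (simp add: power2_eq_square algebra_simps)
  also have "\<dots> = t'\<^sup>2 - 1 + (t * c)\<^sup>2" using ff f'1 xx by simp
  also have "0 < \<dots>" using t'1 one_less_power[of t' 2] zero_le_power2[of "t * c"] by linarith
  finally have "0 < f' \<bullet> w" using t'1 by (simp add: zero_less_mult_iff)
  then show "outgoing f' w" using f'3 f'1 ww w0 by (simp add: outgoing_def)
qed

text \<open>The slope \<open>3/4\<close> governs the first hit and the line before it; all later
  hits are controlled by the decrease of the heights.\<close>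

lemma outgoing_trajectory:
  assumes o: "outgoing f v" and h: "\<bar>v $ 3\<bar> = 3/4"
  shows "\<exists>\<gamma>. billiard_trajectory {mirror} (oriented_line v f) \<gamma> \<and> nonsingular {mirror} \<gamma> \<and>
    (\<exists>t\<^sub>0. \<forall>t. \<gamma> t \<in> cball 0 2 \<longleftrightarrow> t\<^sub>0 \<le> t)"
proof -
  define S where "S n = ((\<lambda>(f, v). (next_focal f v, reflect (hit_point f v) v)) ^^ n) (f, v)" for n
  define F where "F n = fst (S n)" for n
  define W where "W n = snd (S n)" for n
  define X where "X n = hit_point (F n) (W n)" for n
  have F0: "F 0 = f" "W 0 = v" by (simp_all add: F_def W_def S_def)
  have rec: "F (Suc n) = next_focal (F n) (W n)" "W (Suc n) = reflect (X n) (W n)" for n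
    by (simp_all add: F_def W_def X_def S_def case_prod_beta)
  define \<tau> where "\<tau> n = hit_time (F n) (W n)" for n
  define \<rho> where "\<rho> n = return_time (F n) (W n)" for n
  \<comment> \<open>Time 0 is the foot point of \<open>oriented_line v f\<close>, so
    \<open>f\<close> is passed at time \<open>f \<bullet> v\<close> and the first hit comes
    \<open>\<tau> 0\<close> later. A further round is the return to the circle plus the way to the
    next hit.\<close>
  define T where "T n = f \<bullet> v + \<tau> 0 + (\<Sum>k<n. \<rho> k + \<tau> (Suc k))" for n
  have out: "outgoing (F n) (W n)" for n
  proof (induction n)
    case (Suc n)
    then show ?case using outgoing_next(3)[of "F n" "W n"] by (simp add: rec X_def)
  qed (simp add: F0 o)
  note \<tau> = hit_time[OF out, folded \<tau>_def]
  note \<rho> = outgoing_next[OF out, folded X_def \<rho>_def rec]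
  have X_eq: "X n = F n + \<tau> n *\<^sub>R W n" for n by (simp add: X_def \<tau>_def hit_point_def)
  have X3: "X n $ 3 = \<tau> n * W n $ 3" for n unfolding X_def \<tau>_def by (rule hit_point_nth_3[OF out])
  have T: "T (Suc n) - T n = \<rho> n + \<tau> (Suc n)" for n by (simp add: T_def)
  have "(v $ 3)\<^sup>2 = (3/4)\<^sup>2" unfolding h[symmetric] by simp
  then have c: "(v $ 3)\<^sup>2 = 9/16" by (simp add: power_divide)
  have small: "\<bar>X n $ 3\<bar> < 3/5" for n
  proof (induction n)
    case 0
    have "0 < 2 * (f \<bullet> v) * \<tau> 0" using o \<tau>(1)[of 0] by (simp add: outgoing_def)
    then have "(1 + (v $ 3)\<^sup>2) * (\<tau> 0)\<^sup>2 < 1" using \<tau>(3)[of 0] unfolding F0 by linarith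
    then have "25/16 * (\<tau> 0)\<^sup>2 < 1" unfolding c by simp
    then have "(\<tau> 0 * v $ 3)\<^sup>2 < (3/5)\<^sup>2" by (simp add: power_mult_distrib c power_divide)
    then have "\<bar>\<tau> 0 * v $ 3\<bar>\<^sup>2 < (3/5)\<^sup>2" by simp
    from power2_less_imp_less[OF this] show ?case unfolding X3 F0 by simp
  next
    case (Suc n)
    \<comment> \<open>Between two hits the velocity is constant and the ray crosses height 0, so the
      heights are in the ratio of \<open>\<tau> (Suc n) < 1\<close> to
      \<open>\<rho> n > 1\<close>.\<close>
    have "\<bar>X (Suc n) $ 3\<bar> = \<tau> (Suc n) * \<bar>W (Suc n) $ 3\<bar>"
      using \<tau>(1)[of "Suc n"] by (simp add: X3 abs_mult)
    also have "\<dots> \<le> \<rho> n * \<bar>W (Suc n) $ 3\<bar>"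
      using \<tau>(2)[of "Suc n"] \<rho>(2)[of n] by (intro mult_right_mono) auto
    also have "\<dots> = \<bar>X n $ 3\<bar>" using \<rho>(2,4)[of n] by (simp add: abs_mult)
    finally show ?case using Suc by simp
  qed
  have pre: "X 0 + t *\<^sub>R W 0 \<notin> mirror" if t: "t < 0" for t
  proof
    assume m: "X 0 + t *\<^sub>R W 0 \<in> mirror"
    let ?r = "\<tau> 0 + t"
    have e: "X 0 + t *\<^sub>R W 0 = f + ?r *\<^sub>R v"
      by (simp add: X_eq F0 scaleR_left_distrib)
    have eq: "2 * (f \<bullet> v) * ?r + 25/16 * ?r\<^sup>2 = 1"
      using m quad_focal_line[OF o, of ?r] unfolding e by (simp add: mirror_iff c)
    have eq0: "2 * (f \<bullet> v) * \<tau> 0 + 25/16 * (\<tau> 0)\<^sup>2 = 1"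
      using \<tau>(3)[of 0] by (simp add: F0 c)
    have D: "0 < f \<bullet> v" using o by (simp add: outgoing_def)
    \<comment> \<open>For nonnegative parameters the left side of \<open>eq\<close> is strictly
      increasing, so no crossing lies between the circle and the first hit.\<close>
    have "?r < 0"
    proof (rule ccontr)
      assume "\<not> ?r < 0"
      then have "0 \<le> ?r" "?r < \<tau> 0" using t by auto
      then have "?r\<^sup>2 \<le> (\<tau> 0)\<^sup>2" "(f \<bullet> v) * ?r < (f \<bullet> v) * \<tau> 0"
        using D by (auto intro: power_mono mult_strict_left_mono)
      then show False using eq eq0 by (simp add: mult.assoc)
    qed
    \<comment> \<open>Behind the circle the linear term is negative, which pushes the crossing
      beyond the level \<open>3/5\<close>, off the band.\<close>
    then have "2 * (f \<bullet> v) * ?r < 0" using D by (simp add: mult_pos_neg)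
    then have "1 < 25/16 * ?r\<^sup>2" using eq by linarith
    moreover have "((f + ?r *\<^sub>R v) $ 3)\<^sup>2 = 9/16 * ?r\<^sup>2"
      using o by (simp add: outgoing_def power_mult_distrib c)
    moreover have "\<bar>(f + ?r *\<^sub>R v) $ 3\<bar>\<^sup>2 \<le> (3/5)\<^sup>2"
      using m unfolding e mirror_iff by (intro power_mono) auto
    ultimately show False by (simp add: power_divide)
  qed
  \<comment> \<open>On the line, membership in the ball of radius 2 becomes
    \<open>\<bar>r + f \<bullet> v\<bar> \<le> R\<close> by completing the square; 3 is
    \<open>2^2 - 1\<close>.\<close>
  define R where "R = sqrt ((f \<bullet> v)\<^sup>2 + 3)"
  have R: "R\<^sup>2 = (f \<bullet> v)\<^sup>2 + 3" "0 \<le> R" by (simp_all add: R_def)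
  have D: "0 < f \<bullet> v" using o by (simp add: outgoing_def)
  have D1: "f \<bullet> v \<le> 1"
    using norm_cauchy_schwarz[of f v] o by (simp add: outgoing_def norm_eq_sqrt_inner)
  have ball: "X 0 + t *\<^sub>R W 0 \<in> cball 0 2 \<longleftrightarrow> - (f \<bullet> v) - R - \<tau> 0 \<le> t" if t: "t \<le> 0" for t
  proof -
    let ?r = "\<tau> 0 + t"
    have e: "X 0 + t *\<^sub>R W 0 = f + ?r *\<^sub>R v"
      by (simp add: X_eq F0 scaleR_left_distrib)
    have n: "(norm (f + ?r *\<^sub>R v))\<^sup>2 = 1 + 2 * (f \<bullet> v) * ?r + ?r\<^sup>2"
      using o unfolding dot_square_norm[symmetric]
      by (simp add: outgoing_def inner_add_left inner_add_right inner_commute[of v f] power2_eq_square algebra_simps)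
    have "f + ?r *\<^sub>R v \<in> cball 0 2 \<longleftrightarrow> (norm (f + ?r *\<^sub>R v))\<^sup>2 \<le> 2\<^sup>2"
      using abs_le_square_iff[of "norm (f + ?r *\<^sub>R v)" 2] by simp
    also have "\<dots> \<longleftrightarrow> (?r + f \<bullet> v)\<^sup>2 \<le> R\<^sup>2"
      unfolding n R by (simp add: power2_eq_square algebra_simps)
    also have "\<dots> \<longleftrightarrow> \<bar>?r + f \<bullet> v\<bar> \<le> R"
      using R(2) abs_le_square_iff[of "?r + f \<bullet> v" R] by simp
    also have "\<dots> \<longleftrightarrow> - R \<le> ?r + f \<bullet> v"
    proof -
      \<comment> \<open>Up to the first hit the parameter is below 1, so this bound makes the exit
        inequality automatic and only the entry inequality remains.\<close>
      have "(1 + f \<bullet> v)\<^sup>2 \<le> R\<^sup>2" unfolding R using D1 by (simp add: power2_eq_square algebra_simps)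
      then have "1 + f \<bullet> v \<le> R" using R(2) by (rule power2_le_imp_le)
      then show ?thesis using t \<tau>(2)[of 0] by auto
    qed
    finally show ?thesis unfolding e by auto
  qed
  show ?thesis
  proof (rule polygonal_billiard[of T X W])
    show "T n + 1 \<le> T (Suc n)" for n using T[of n] \<rho>(2)[of n] \<tau>(1)[of "Suc n"] by simp
    show "X (Suc n) = X n + (T (Suc n) - T n) *\<^sub>R W (Suc n)" for n
      unfolding T X_eq[of "Suc n"]
      by (simp add: rec(1) next_focal_def rec(2) X_def[symmetric] \<rho>_def[symmetric] scaleR_left_distrib)
    show "quad (X n) = 2" for n unfolding X_def by (rule quad_hit_point[OF out])
    show "norm (W n) = 1" for n using out[of n] by (simp add: outgoing_def norm_eq_sqrt_inner)
    show "- (f \<bullet> v) - R - \<tau> 0 \<le> 0" using D R(2) \<tau>(1)[of 0] by simp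
    show "snd (oriented_line v f) + t *\<^sub>R fst (oriented_line v f) = X 0 + (t - T 0) *\<^sub>R W 0" for t
      by (simp add: oriented_line_def X_eq F0 T_def algebra_simps)
  qed (use small rec(2) \<rho>(1) pre ball in auto)
qed

section \<open>The family of lines\<close>

text \<open>\<open>7/16 = 1 - (3/4)^2\<close> makes the direction a unit vector. Here and in
  \<open>family_focus\<close> only an open half of the circle is kept, so that a single chart covers
  the family.\<close>

definition family_dir :: "real^3 \<Rightarrow> bool" where
  "family_dir u \<longleftrightarrow> (u $ 1)\<^sup>2 + (u $ 2)\<^sup>2 = 7/16 \<and> u $ 3 = 3/4 \<and> 0 < u $ 1"

definition family_focus :: "real^3 \<Rightarrow> bool" where
  "family_focus q \<longleftrightarrow> (q $ 1)\<^sup>2 + (q $ 2)\<^sup>2 = 1 \<and> q $ 3 = 0 \<and> 0 < q $ 1"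

definition family :: "((real^3) \<times> (real^3)) set" where
  "family = {oriented_line u q | u q. family_dir u \<and> family_focus q \<and> 0 < q \<bullet> u}"

lemma family_dir_unit:
  assumes "family_dir u"
  shows "u \<bullet> u = 1"
proof -
  have "u $ 3 = 3/4" using assms unfolding family_dir_def by blast
  then have "u $ 3 * u $ 3 = 9/16" by (simp only:)
  then show ?thesis using assms by (simp add: family_dir_def inner_3 power2_eq_square)
qed

lemma family_focus_unit: "family_focus q \<Longrightarrow> q \<bullet> q = 1"
  by (simp add: family_focus_def inner_3 power2_eq_square)

lemma family_subset_L3: "family \<subseteq> L3"
proof
  fix l assume "l \<in> family"
  then obtain u q where l: "l = oriented_line u q" "u \<bullet> u = 1"
    unfolding family_def using family_dir_unit by blast
  then show "l \<in> L3"
    by (simp add: L3_def oriented_line_def norm_eq_sqrt_inner inner_diff_right inner_commute[of u q])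
qed

text \<open>The point where the line meets the plane of the focal circle.\<close>

definition ground :: "(real^3) \<times> (real^3) \<Rightarrow> real^3" where
  "ground x = snd x - (snd x $ 3 / fst x $ 3) *\<^sub>R fst x"

lemma ground_oriented_line:
  "u $ 3 \<noteq> 0 \<Longrightarrow> q $ 3 = 0 \<Longrightarrow> ground (oriented_line u q) = q"
  by (simp add: ground_def oriented_line_def)

lemma oriented_line_ground:
  assumes "fst x \<bullet> fst x = 1" "fst x \<bullet> snd x = 0"
  shows "oriented_line (fst x) (ground x) = x"
proof -
  define m where "m = snd x $ 3 / fst x $ 3"
  have g: "ground x = snd x - m *\<^sub>R fst x" by (simp add: ground_def m_def)
  have "ground x \<bullet> fst x = - m" using assms by (simp add: g inner_diff_left inner_commute[of "snd x" "fst x"])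
  then show ?thesis by (simp add: oriented_line_def g)
qed

lemma embedded_submanifold_family: "embedded_submanifold 2 family"
proof -
  \<comment> \<open>The last two conditions are positivity of \<open>ground x $ 1\<close> and of
    \<open>ground x \<bullet> fst x\<close>, multiplied by \<open>fst x $ 3\<close>: without the
    division, openness is a matter of continuous functions.\<close>
  define U :: "((real^3) \<times> (real^3)) set" where "U = {x. 0 < fst x $ 1} \<inter> {x. 0 < fst x $ 3} \<inter>
    {x. 0 < snd x $ 1 * fst x $ 3 - snd x $ 3 * fst x $ 1} \<inter>
    {x. 0 < (snd x \<bullet> fst x) * fst x $ 3 - snd x $ 3 * (fst x \<bullet> fst x)}"
  define a where "a = (\<lambda>y :: (real^3) \<times> (real^3). fst y $ 1 + 7/16 - (fst y $ 2)\<^sup>2)"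
  define c where "c = (\<lambda>y :: (real^3) \<times> (real^3). snd y $ 1 + 1 - (snd y $ 2)\<^sup>2)"
  define V :: "((real^3) \<times> (real^3)) set" where "V = {y. 0 < a y} \<inter> {y. 0 < c y} \<inter>
    {y. 0 < fst y $ 3 + 3/4} \<inter> {y. 0 < sqrt (c y) * sqrt (a y) + snd y $ 2 * fst y $ 2}"
  \<comment> \<open>Four components are the equations of the family; the second coordinates of the
    direction and of the ground point remain free.\<close>
  define \<phi> :: "(real^3) \<times> (real^3) \<Rightarrow> (real^3) \<times> (real^3)" where "\<phi> = (\<lambda>x.
    (vector [(fst x $ 1)\<^sup>2 + (fst x $ 2)\<^sup>2 - 7/16, fst x $ 2, fst x $ 3 - 3/4],
     vector [(ground x $ 1)\<^sup>2 + (ground x $ 2)\<^sup>2 - 1, ground x $ 2, fst x \<bullet> snd x]))"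
  define u where "u = (\<lambda>y. vector [sqrt (a y), fst y $ 2, fst y $ 3 + 3/4] :: real^3)"
  define q where "q = (\<lambda>y. vector [sqrt (c y), snd y $ 2, 0] :: real^3)"
  \<comment> \<open>Slides \<open>q y\<close> along the line until its inner product with
    \<open>u y\<close> has the prescribed value; the value 0 gives the foot of the perpendicular
    from the origin.\<close>
  define \<psi> where "\<psi> = (\<lambda>y. (u y, q y + ((snd y $ 3 - q y \<bullet> u y) / (u y \<bullet> u y)) *\<^sub>R u y))"
  have oU: "open U"
    unfolding U_def by (intro open_Int open_Collect_less continuous_intros)
  have oV: "open V"
    unfolding V_def a_def c_def by (intro open_Int open_Collect_less continuous_intros)
  have cg: "Ck_on k ground U" for k
    unfolding ground_def by (intro oU Ck_on_intros) (auto simp: U_def)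
  have c\<phi>: "Ck_on k \<phi> U" for k
    unfolding \<phi>_def by (intro oU Ck_on_intros Ck_on_vector_3 cg)
  have ca: "Ck_on k (\<lambda>y. sqrt (a y)) V" for k
    unfolding a_def by (intro oV Ck_on_intros) (auto simp: V_def a_def)
  have cc: "Ck_on k (\<lambda>y. sqrt (c y)) V" for k
    unfolding c_def by (intro oV Ck_on_intros) (auto simp: V_def c_def)
  have cu: "Ck_on k u V" for k
    unfolding u_def by (intro oV ca Ck_on_intros Ck_on_vector_3)
  have cq: "Ck_on k q V" for k
    unfolding q_def by (intro oV cc Ck_on_intros Ck_on_vector_3)
  have u0: "0 < u y \<bullet> u y" if "y \<in> V" for y
  proof -
    have "u y $ 1 \<noteq> 0" using that by (auto simp: V_def u_def)
    then show ?thesis by (auto simp: inner_gt_zero_iff vec_eq_iff)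
  qed
  have c\<psi>: "Ck_on k \<psi> V" for k
    unfolding \<psi>_def by (intro oV cu cq u0 Ck_on_intros)
  have g: "ground x $ 3 = 0" "ground x $ 1 = (snd x $ 1 * fst x $ 3 - snd x $ 3 * fst x $ 1) / fst x $ 3"
    "ground x \<bullet> fst x = ((snd x \<bullet> fst x) * fst x $ 3 - snd x $ 3 * (fst x \<bullet> fst x)) / fst x $ 3"
    if "0 < fst x $ 3" for x
    using that by (simp_all add: ground_def inner_diff_left field_simps)
  have U: "x \<in> U \<longleftrightarrow> 0 < fst x $ 1 \<and> 0 < fst x $ 3 \<and> 0 < ground x $ 1 \<and> 0 < ground x \<bullet> fst x" for x
    by (cases "0 < fst x $ 3") (auto simp: U_def g zero_less_divide_iff)
  have \<phi>a: "a (\<phi> x) = (fst x $ 1)\<^sup>2" "c (\<phi> x) = (ground x $ 1)\<^sup>2" for x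
    by (simp_all add: a_def c_def \<phi>_def)
  have 1: "\<phi> x \<in> V \<and> \<psi> (\<phi> x) = x" if x: "x \<in> U" for x
  proof -
    have x': "0 < fst x $ 1" "0 < fst x $ 3" "0 < ground x $ 1" "0 < ground x \<bullet> fst x"
      using x U by auto
    have ux: "u (\<phi> x) = fst x" using x'(1)
      by (auto simp: vec_eq_iff forall_3 u_def \<phi>a) (auto simp: \<phi>_def)
    have qx: "q (\<phi> x) = ground x" using x'(3) g(1)[OF x'(2)]
      by (auto simp: vec_eq_iff forall_3 q_def \<phi>a) (auto simp: \<phi>_def)
    have "fst x \<noteq> 0" using x'(1) by auto
    then have f0: "fst x \<bullet> fst x \<noteq> 0" by simp
    have "fst x \<bullet> snd x - ground x \<bullet> fst x = snd x $ 3 / fst x $ 3 * (fst x \<bullet> fst x)"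
      by (simp add: ground_def inner_diff_left inner_commute[of "snd x" "fst x"])
    then have "snd (\<phi> x) $ 3 - q (\<phi> x) \<bullet> u (\<phi> x) = snd x $ 3 / fst x $ 3 * (fst x \<bullet> fst x)"
      unfolding ux qx by (simp add: \<phi>_def)
    then have "\<psi> (\<phi> x) = (fst x, ground x + (snd x $ 3 / fst x $ 3) *\<^sub>R fst x)"
      using f0 by (simp add: \<psi>_def ux qx)
    then have "\<psi> (\<phi> x) = x" by (simp add: ground_def prod_eq_iff)
    moreover have "\<phi> x \<in> V"
    proof -
      have "0 < a (\<phi> x)" "0 < c (\<phi> x)" using x' by (simp_all add: \<phi>a)
      moreover have "sqrt (c (\<phi> x)) * sqrt (a (\<phi> x)) + snd (\<phi> x) $ 2 * fst (\<phi> x) $ 2 = ground x \<bullet> fst x"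
        using x' g(1)[OF x'(2)] by (simp add: \<phi>a inner_3) (simp add: \<phi>_def)
      moreover have "fst (\<phi> x) $ 3 + 3/4 = fst x $ 3" by (simp add: \<phi>_def)
      ultimately show ?thesis using x' by (simp add: V_def)
    qed
    ultimately show ?thesis by simp
  qed
  have 2: "\<psi> y \<in> U \<and> \<phi> (\<psi> y) = y" if y: "y \<in> V" for y
  proof -
    have y': "0 < a y" "0 < c y" "0 < fst y $ 3 + 3/4" "0 < q y \<bullet> u y"
      using y by (auto simp: V_def inner_3 u_def q_def)
    have uy: "u y $ 1 = sqrt (a y)" "u y $ 2 = fst y $ 2" "u y $ 3 = fst y $ 3 + 3/4"
      by (simp_all add: u_def)
    have qy: "q y $ 1 = sqrt (c y)" "q y $ 2 = snd y $ 2" "q y $ 3 = 0"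
      by (simp_all add: q_def)
    have f: "fst (\<psi> y) = u y" by (simp add: \<psi>_def)
    have gy: "ground (\<psi> y) = q y"
      using y'(3) uy qy by (simp add: \<psi>_def ground_def)
    have in3: "u y \<bullet> snd (\<psi> y) = snd y $ 3"
      using u0[OF y] by (simp add: \<psi>_def inner_add_right inner_commute)
    have "\<psi> y \<in> U" using y' uy qy by (simp add: U f gy)
    moreover have "\<phi> (\<psi> y) = y"
      using y'(1,2) unfolding \<phi>_def f gy in3 uy qy
      by (auto simp: prod_eq_iff vec_eq_iff forall_3) (auto simp: a_def c_def)
    ultimately show ?thesis by simp
  qed
  have d: "diffeomorphism U V \<phi> \<psi>"
    by (rule diffeomorphism_openI[OF oU oV c\<phi> c\<psi> 1 2])
  define L :: "((real^3) \<times> (real^3)) set" where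
    "L = {y. fst y $ 1 = 0 \<and> fst y $ 3 = 0 \<and> snd y $ 1 = 0 \<and> snd y $ 3 = 0}"
  have sub: "family \<subseteq> U"
  proof
    fix x assume "x \<in> family"
    then obtain u q where x: "x = oriented_line u q" "family_dir u" "family_focus q" "0 < q \<bullet> u"
      unfolding family_def by blast
    have "ground x = q" unfolding x(1)
      using x by (intro ground_oriented_line) (auto simp: family_dir_def family_focus_def)
    then show "x \<in> U"
      using x by (auto simp: U family_dir_def family_focus_def oriented_line_def)
  qed
  have fam: "x \<in> family \<longleftrightarrow> \<phi> x \<in> L" if x: "x \<in> U" for x
  proof
    assume "x \<in> family"
    then obtain u q where l: "x = oriented_line u q" "family_dir u" "family_focus q"
      unfolding family_def by blast
    have "ground x = q" unfolding l(1)
      using l by (intro ground_oriented_line) (auto simp: family_dir_def family_focus_def)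
    moreover have "fst x \<bullet> snd x = 0"
      using family_subset_L3 \<open>x \<in> family\<close> by (auto simp: L3_def)
    ultimately show "\<phi> x \<in> L"
      using l by (auto simp: L_def \<phi>_def family_dir_def family_focus_def oriented_line_def)
  next
    assume "\<phi> x \<in> L"
    then have l: "family_dir (fst x)" "family_focus (ground x)" "fst x \<bullet> snd x = 0" "0 < ground x \<bullet> fst x"
      using x g(1)[of x] by (auto simp: L_def \<phi>_def family_dir_def family_focus_def U)
    then have "x = oriented_line (fst x) (ground x)"
      using oriented_line_ground[OF family_dir_unit] by simp
    then show "x \<in> family" unfolding family_def using l by blast
  qed
  have im: "\<phi> ` (U \<inter> family) = V \<inter> L"
  proof (intro set_eqI iffI)
    fix y assume "y \<in> \<phi> ` (U \<inter> family)"
    then show "y \<in> V \<inter> L" using 1 fam by blast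
  next
    fix y assume y: "y \<in> V \<inter> L"
    then have "\<psi> y \<in> U" "\<phi> (\<psi> y) = y" using 2 by auto
    then show "y \<in> \<phi> ` (U \<inter> family)" using fam[of "\<psi> y"] y by force
  qed
  have "subspace L" by (auto simp: L_def subspace_def)
  moreover have "dim L = 2"
  proof -
    define B :: "((real^3) \<times> (real^3)) set" where "B = {(axis 2 1, 0), (0, axis 2 1)}"
    have Basis_eq: "(Basis :: ((real^3) \<times> (real^3)) set) =
        range (\<lambda>i. (axis i 1, 0)) \<union> range (\<lambda>i. (0, axis i 1))"
      by (auto simp: Basis_prod_def Basis_vec_def)
    have B: "B \<subseteq> Basis" unfolding Basis_eq B_def by blast
    have mem: "(axis i 1, 0) \<in> B \<longleftrightarrow> i = 2" "(0, axis i 1) \<in> B \<longleftrightarrow> i = 2" for i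
      by (auto simp: B_def axis_eq_axis axis_eq_0_iff)
    have inner: "x \<bullet> (axis i 1, 0) = fst x $ i" "x \<bullet> (0, axis i 1) = snd x $ i"
      for x :: "(real^3) \<times> (real^3)" and i
      by (simp_all add: inner_prod_def inner_axis)
    have "x \<in> {x. \<forall>i\<in>Basis. i \<notin> B \<longrightarrow> x \<bullet> i = 0} \<longleftrightarrow> x \<in> L" for x
      unfolding Basis_eq ball_Un ball_simps mem_Collect_eq mem inner forall_3 L_def
      by auto
    then have "{x. \<forall>i\<in>Basis. i \<notin> B \<longrightarrow> x \<bullet> i = 0} = L" by blast
    moreover have "card B = 2" by (simp add: B_def axis_eq_0_iff)
    ultimately show ?thesis using dim_substandard[OF B] by simp
  qed
  ultimately show ?thesis
    unfolding embedded_submanifold_def interior_chart_at_def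
    using oU oV d im sub by blast
qed

section \<open>Failure of normality\<close>

lemma tangent_space_image:
  assumes "open B" "smooth_on G B" "G ` B \<subseteq> S" "z \<in> B" "(G has_derivative G') (at z)"
  shows "G' e \<in> tangent_space S (G z)"
proof -
  obtain r where r: "0 < r" "ball z r \<subseteq> B" using assms(1,4) openE by blast
  \<comment> \<open>The added 1 covers the direction \<open>e = 0\<close>.\<close>
  define d where "d = r / (norm e + 1)"
  have n: "0 < norm e + 1" by (simp add: add_nonneg_pos)
  have d: "0 < d" using r(1) n by (simp add: d_def)
  define k where "k = (\<lambda>t. z + t *\<^sub>R e)"
  have kB: "k ` {-d<..<d} \<subseteq> B"
  proof (rule order_trans[OF _ r(2)], rule image_subsetI)
    fix t assume "t \<in> {-d<..<d}"
    then have "\<bar>t\<bar> < d" by auto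
    then have "\<bar>t\<bar> * (norm e + 1) < r" using n by (simp add: d_def pos_less_divide_eq)
    moreover have "\<bar>t\<bar> * norm e \<le> \<bar>t\<bar> * (norm e + 1)" by (intro mult_left_mono) auto
    ultimately show "k t \<in> ball z r" by (simp add: k_def dist_norm)
  qed
  have "Ck_on m k {-d<..<d}" for m
    unfolding k_def by (intro Ck_on_add Ck_on_const Ck_on_scaleR Ck_on_id open_greaterThanLessThan)
  then have "smooth_on k {-d<..<d}" by (rule smooth_on_open[OF open_greaterThanLessThan])
  from smooth_on_compose[OF this assms(2) kB] have "smooth_on (\<lambda>t. G (k t)) {-d<..<d}" .
  moreover have "(k has_derivative (\<lambda>t. t *\<^sub>R e)) (at 0)"
    unfolding k_def by (auto intro!: derivative_eq_intros)
  then have "((\<lambda>t. G (k t)) has_derivative (\<lambda>t. G' (t *\<^sub>R e))) (at 0)"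
    by (rule has_derivative_compose) (simp add: k_def assms(5))
  then have "((\<lambda>t. G (k t)) has_vector_derivative G' e) (at 0)"
    using has_derivative_bounded_linear[OF assms(5)]
    by (simp add: has_vector_derivative_def bounded_linear.linear linear_scale)
  moreover have "(\<lambda>t. G (k t)) ` {-d<..<d} \<subseteq> S" using kB assms(3) by blast
  moreover have "G (k 0) = G z" by (simp add: k_def)
  ultimately show ?thesis unfolding tangent_space_def using d
    by (intro CollectI exI[of _ "\<lambda>t. G (k t)"] exI[of _ d]) simp
qed

definition udir :: "real \<Rightarrow> real^3" where
  "udir s = vector [sqrt (7/16 - s\<^sup>2), s, 3/4]"

definition foc :: "real \<Rightarrow> real^3" where
  "foc y = vector [sqrt (1 - y\<^sup>2), y, 0]"

definition parameter_box :: "real \<Rightarrow> (real \<times> real) set" where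
  "parameter_box \<epsilon> = {-\<epsilon><..<\<epsilon>} \<times> {-\<epsilon><..<\<epsilon>}"

lemma open_parameter_box: "open (parameter_box \<epsilon>)"
  unfolding parameter_box_def by (intro open_Times open_greaterThanLessThan)

lemma square_small:
  fixes x :: real
  assumes "x \<in> {-(1/4)<..<1/4}"
  shows "x\<^sup>2 < 1/16"
proof -
  have "\<bar>x\<bar> < 1/4" using assms by (auto simp: abs_if)
  then show ?thesis using abs_square_less_1[of "4 * x"] by (simp add: power_mult_distrib abs_mult)
qed

lemma family_param:
  assumes "z \<in> parameter_box (1/4)"
  shows "family_dir (udir (snd z))" "family_focus (foc (fst z))" "0 < foc (fst z) \<bullet> udir (snd z)"
proof -
  have z: "fst z \<in> {-(1/4)<..<1/4}" "snd z \<in> {-(1/4)<..<1/4}"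
    using assms unfolding parameter_box_def mem_Times_iff by simp_all
  then have abs: "\<bar>fst z\<bar> \<le> 1/4" "\<bar>snd z\<bar> \<le> 1/4" by (auto simp: abs_if)
  note sq = square_small[OF z(1)] square_small[OF z(2)]
  show "family_dir (udir (snd z))" "family_focus (foc (fst z))"
    using sq by (auto simp: family_dir_def udir_def family_focus_def foc_def)
  \<comment> \<open>Both radicands exceed \<open>1/4\<close> on the box, so the product of the roots
    is at least \<open>1/4\<close> and beats the cross term, which is at most
    \<open>1/16\<close>.\<close>
  have "1/2 \<le> sqrt (1 - (fst z)\<^sup>2)" "1/2 \<le> sqrt (7/16 - (snd z)\<^sup>2)"
    by (rule real_le_rsqrt, use sq in \<open>simp add: power_divide\<close>)+
  then have "1/2 * (1/2) \<le> sqrt (1 - (fst z)\<^sup>2) * sqrt (7/16 - (snd z)\<^sup>2)"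
    using sq by (intro mult_mono) auto
  moreover have "\<bar>fst z * snd z\<bar> \<le> 1/4 * (1/4)"
    unfolding abs_mult using abs by (intro mult_mono) auto
  ultimately show "0 < foc (fst z) \<bullet> udir (snd z)"
    by (simp add: inner_3 foc_def udir_def)
qed

lemma smooth_param: "smooth_on (\<lambda>z. oriented_line (udir (snd z)) (foc (fst z))) (parameter_box (1/4))"
  and smooth_udir: "smooth_on udir {-(1/4)<..<1/4}"
proof -
  let ?B = "parameter_box (1/4)"
  note o = open_parameter_box[of "1/4"]
  have pos: "0 < 7/16 - (snd z)\<^sup>2" "0 < 1 - (fst z)\<^sup>2" if "z \<in> ?B" for z
  proof -
    have "fst z \<in> {-(1/4)<..<1/4}" "snd z \<in> {-(1/4)<..<1/4}"
      using that unfolding parameter_box_def mem_Times_iff by simp_all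
    then show "0 < 7/16 - (snd z)\<^sup>2" "0 < 1 - (fst z)\<^sup>2"
      by (auto dest!: square_small simp del: greaterThanLessThan_iff)
  qed
  have u: "Ck_on k (\<lambda>z. udir (snd z)) ?B" for k
    unfolding udir_def by (intro o pos Ck_on_intros Ck_on_vector_3)
  have f: "Ck_on k (\<lambda>z. foc (fst z)) ?B" for k
    unfolding foc_def by (intro o pos Ck_on_intros Ck_on_vector_3)
  show "smooth_on (\<lambda>z. oriented_line (udir (snd z)) (foc (fst z))) ?B"
    unfolding oriented_line_def by (intro smooth_on_open o Ck_on_intros u f)
  have pos': "0 < 7/16 - s\<^sup>2" if "s \<in> {-(1/4)<..<1/4}" for s :: real
    using square_small[OF that] by simp
  show "smooth_on udir {-(1/4)<..<1/4}"
    unfolding udir_def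
    by (intro smooth_on_open open_greaterThanLessThan pos' Ck_on_intros Ck_on_vector_3)
qed

text \<open>A surface normal to the family meets the line with parameters \<open>(y, s)\<close> at
  \<open>foc y + \<lambda> (y, s) *\<^sub>R udir s\<close>.  Orthogonality forces \<open>\<partial>\<lambda>/\<partial>s = 0\<close> everywhere, but
  \<open>\<partial>\<lambda>/\<partial>y = -s\<close> at \<open>y = 0\<close>.\<close>

lemma non_normal_family: "non_normal family"
  unfolding non_normal_def
proof
  assume "locally_normal family"
  let ?h = "\<lambda>z. oriented_line (udir (snd z)) (foc (fst z))"
  have hF: "?h z \<in> family" if "z \<in> parameter_box (1/4)" for z
    unfolding family_def using family_param[OF that] by blast
  have "(0, 0) \<in> parameter_box (1/4)" by (simp add: parameter_box_def)
  then have "?h (0, 0) \<in> family" by (rule hF)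
  then obtain V S N g where V: "openin (top_of_set family) V" "?h (0, 0) \<in> V"
    and N: "\<forall>x\<in>S. unit_normal_at S x (N x)"
    and diff: "diffeomorphism S V (\<lambda>x. oriented_line (N x) x) g"
    using \<open>locally_normal family\<close> unfolding locally_normal_def by meson
  obtain Z where Z: "open Z" "V = family \<inter> Z" using V(1) by (auto simp: openin_open)
  have "continuous_on (parameter_box (1/4)) ?h"
    using smooth_on_imp_differentiable[OF smooth_param open_parameter_box]
    by (intro continuous_at_imp_continuous_on ballI differentiable_imp_continuous_within)
  then have "open (parameter_box (1/4) \<inter> ?h -` Z)"
    by (rule continuous_open_preimage[OF _ open_parameter_box Z(1)])
  moreover have "(0, 0) \<in> parameter_box (1/4) \<inter> ?h -` Z"
    using V(2) Z(2) by (simp add: parameter_box_def)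
  ultimately obtain P Q where PQ: "open P" "open Q" "0 \<in> P" "0 \<in> Q" "P \<times> Q \<subseteq> parameter_box (1/4) \<inter> ?h -` Z"
    by (rule open_prod_elim) auto
  obtain e1 e2 where e: "0 < e1" "ball 0 e1 \<subseteq> P" "0 < e2" "ball 0 e2 \<subseteq> Q"
    using PQ(1-4) by (meson openE)
  define \<epsilon> where "\<epsilon> = min e1 e2"
  have \<epsilon>: "0 < \<epsilon>" using e by (simp add: \<epsilon>_def)
  let ?B = "parameter_box \<epsilon>"
  have "?B \<subseteq> P \<times> Q"
    using e(2,4) by (auto simp: parameter_box_def \<epsilon>_def subset_iff dist_real_def)
  then have BZ: "?B \<subseteq> parameter_box (1/4) \<inter> ?h -` Z" using PQ(5) by (rule order_trans)
  have B: "?B \<subseteq> parameter_box (1/4)" "?h ` ?B \<subseteq> V"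
  proof -
    show "?B \<subseteq> parameter_box (1/4)" using BZ by blast
    show "?h ` ?B \<subseteq> V"
    proof (rule image_subsetI)
      fix z assume "z \<in> ?B"
      then have z: "z \<in> parameter_box (1/4)" "?h z \<in> Z" using BZ by blast+
      then show "?h z \<in> V" using hF[OF z(1)] Z(2) by blast
    qed
  qed
  \<comment> \<open>The point of the hypothetical normal surface on the line with parameters
    \<open>z\<close>.\<close>
  define G where "G z = g (?h z)" for z
  have smooth_G: "smooth_on G ?B"
    unfolding G_def using diff B
    by (intro smooth_on_compose[OF smooth_on_subset[OF smooth_param]]) (auto simp: diffeomorphism_def)
  have GS: "G z \<in> S" and line: "oriented_line (N (G z)) (G z) = ?h z" if "z \<in> ?B" for z
    using diff B(2) that unfolding diffeomorphism_def G_def by auto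
  define \<Lambda> where "\<Lambda> y s = (G (y, s) - foc y) \<bullet> udir s" for y s
  have unit: "udir s \<bullet> udir s = 1" if "s \<in> {-(1/4)<..<1/4}" for s
    using family_dir_unit[OF family_param(1)[of "(0, s)"]] that
    by (simp add: parameter_box_def)
  have small: "s \<in> {-(1/4)<..<1/4}" if "(y, s) \<in> ?B" for y s
    using subsetD[OF B(1) that] by (auto simp: parameter_box_def)
  have NG: "N (G (y, s)) = udir s" if "(y, s) \<in> ?B" for y s
    using line[OF that] by (simp add: oriented_line_def)
  have G_eq: "G (y, s) - foc y = \<Lambda> y s *\<^sub>R udir s" if "(y, s) \<in> ?B" for y s
    using line[OF that] NG[OF that]
    by (simp add: oriented_line_def \<Lambda>_def inner_diff_left scaleR_left_diff_distrib algebra_simps)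
  \<comment> \<open>Derivatives of \<open>G\<close> are tangent to \<open>S\<close>, whose normal at
    that point is the direction of the line.\<close>
  have dG: "\<exists>G'. (G has_derivative G') (at (y, s)) \<and> (\<forall>e. G' e \<bullet> udir s = 0)"
    if ys: "(y, s) \<in> ?B" for y s
  proof -
    obtain G' where G': "(G has_derivative G') (at (y, s))"
      using smooth_on_imp_differentiable[OF smooth_G open_parameter_box ys] by (auto simp: differentiable_def)
    have "G' e \<bullet> udir s = 0" for e
    proof -
      have "G' e \<in> tangent_space S (G (y, s))"
        using GS by (intro tangent_space_image[OF open_parameter_box smooth_G _ ys G']) auto
      then show ?thesis
        using N GS[OF ys] NG[OF ys] by (auto simp: unit_normal_at_def inner_commute)
    qed
    with G' show ?thesis by blast
  qed
  have ds: "((\<lambda>s. \<Lambda> y s) has_derivative (\<lambda>t. 0)) (at s)" if ys: "(y, s) \<in> ?B" for y s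
  proof -
    obtain G' where G': "(G has_derivative G') (at (y, s))" "\<And>e. G' e \<bullet> udir s = 0"
      using dG[OF ys] by blast
    have s: "s \<in> {-(1/4)<..<1/4}" using small[OF ys] .
    obtain u' where u': "(udir has_derivative u') (at s)"
      using smooth_on_imp_differentiable[OF smooth_udir open_greaterThanLessThan s]
      by (auto simp: differentiable_def)
    have "((\<lambda>s. udir s \<bullet> udir s) has_derivative (\<lambda>t. udir s \<bullet> u' t + u' t \<bullet> udir s)) (at s)"
      by (rule has_derivative_inner[OF u' u'])
    moreover have "((\<lambda>s. udir s \<bullet> udir s) has_derivative (\<lambda>t. 0)) (at s)"
      by (rule has_derivative_transform_within_open[of "\<lambda>s. 1" _ _ _ "{-(1/4)<..<1/4}"])
         (use s unit in simp_all)
    ultimately have "(\<lambda>t. udir s \<bullet> u' t + u' t \<bullet> udir s) = (\<lambda>t. 0)"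
      by (rule has_derivative_unique)
    then have "udir s \<bullet> u' t + u' t \<bullet> udir s = 0" for t by (rule fun_cong)
    then have uu: "udir s \<bullet> u' t = 0" for t by (simp add: inner_commute)
    have "((\<lambda>s. (y, s)) has_derivative (\<lambda>t. (0, t))) (at s)"
      by (auto intro!: derivative_eq_intros)
    from has_derivative_compose[OF this G'(1)]
    have "((\<lambda>s. G (y, s)) has_derivative (\<lambda>t. G' (0, t))) (at s)" .
    then have "((\<lambda>s. G (y, s) - foc y) has_derivative (\<lambda>t. G' (0, t))) (at s)"
      by (auto intro!: derivative_eq_intros)
    \<comment> \<open>Both terms of the product rule vanish: \<open>G'\<close> is orthogonal to
      \<open>udir s\<close>, and \<open>G - foc\<close> is parallel to \<open>udir s\<close>, hence
      orthogonal to the derivative of this unit field.\<close>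
    from has_derivative_inner[OF this u']
    show ?thesis unfolding \<Lambda>_def[symmetric] by (simp add: G'(2) G_eq[OF ys] uu)
  qed
  have const: "\<Lambda> y s = \<Lambda> y 0" if ys: "(y, s) \<in> ?B" for y s
  proof -
    have y: "y \<in> {-\<epsilon><..<\<epsilon>}" and s: "s \<in> {-\<epsilon><..<\<epsilon>}" and 0: "0 \<in> {-\<epsilon><..<\<epsilon>}"
      using ys \<epsilon> by (simp_all add: parameter_box_def)
    have "(\<Lambda> y has_derivative (\<lambda>t. 0)) (at r within {-\<epsilon><..<\<epsilon>})" if "r \<in> {-\<epsilon><..<\<epsilon>}" for r
    proof -
      have "(y, r) \<in> ?B" using y that by (simp add: parameter_box_def)
      from ds[OF this] show ?thesis by (rule has_derivative_at_withinI)
    qed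
    from has_derivative_zero_unique[OF _ this s 0] show ?thesis by simp
  qed
  have dy: "((\<lambda>y. \<Lambda> y s) has_derivative (\<lambda>t. - (s * t))) (at 0)" if ys: "(0, s) \<in> ?B" for s
  proof -
    obtain G' where G': "(G has_derivative G') (at (0, s))" "\<And>e. G' e \<bullet> udir s = 0"
      using dG[OF ys] by blast
    have "((\<lambda>y. (y, s)) has_derivative (\<lambda>t. (t, 0))) (at 0)"
      by (auto intro!: derivative_eq_intros)
    from has_derivative_compose[OF this G'(1)]
    have "((\<lambda>y. G (y, s)) has_derivative (\<lambda>t. G' (t, 0))) (at 0)" .
    from has_derivative_inner_left[OF this, of "udir s"]
    have 1: "((\<lambda>y. G (y, s) \<bullet> udir s) has_derivative (\<lambda>t. 0)) (at 0)" by (simp add: G'(2))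
    \<comment> \<open>The factor \<open>sqrt (1 - y^2)\<close> is stationary at 0, so only
      \<open>y * s\<close> contributes.\<close>
    have "((\<lambda>y. sqrt (1 - y\<^sup>2) * sqrt (7/16 - s\<^sup>2) + y * s) has_real_derivative s) (at 0)"
      by (auto intro!: derivative_eq_intros)
    then have 2: "((\<lambda>y. sqrt (1 - y\<^sup>2) * sqrt (7/16 - s\<^sup>2) + y * s) has_derivative (*) s) (at 0)"
      by (simp add: has_field_derivative_def)
    have "\<Lambda> y s = G (y, s) \<bullet> udir s - (sqrt (1 - y\<^sup>2) * sqrt (7/16 - s\<^sup>2) + y * s)" for y
      by (simp add: \<Lambda>_def inner_diff_left) (simp add: inner_3 foc_def udir_def)
    then show ?thesis using has_derivative_diff[OF 1 2] by simp
  qed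
  \<comment> \<open>Independence of the direction parameter equates the derivatives in
    \<open>y\<close> at 0 for this \<open>s\<close> and for 0, which are \<open>-s\<close> and
    0.\<close>
  define s where "s = \<epsilon> / 2"
  have s: "0 < s" "(0, s) \<in> ?B" "(0, 0) \<in> ?B" using \<epsilon> by (auto simp: s_def parameter_box_def)
  have "((\<lambda>y. \<Lambda> y s) has_derivative (\<lambda>t. - (0 * t))) (at 0)"
  proof (rule has_derivative_transform_within_open[OF dy[OF s(3)], of "{-\<epsilon><..<\<epsilon>}"])
    show "\<Lambda> y 0 = \<Lambda> y s" if "y \<in> {-\<epsilon><..<\<epsilon>}" for y
    proof -
      have "(y, s) \<in> ?B" using that s(2) by (simp add: parameter_box_def)
      from const[OF this] show ?thesis by simp
    qed
  qed (use \<epsilon> in simp_all)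
  from has_derivative_unique[OF this dy[OF s(2)]]
  have "- (0 * 1) = - (s * 1)" by (rule fun_cong)
  then show False using s(1) by simp
qed

theorem theorem1p2:
  shows "\<exists>(T :: (real^3) set set) (F :: ((real^3) \<times> (real^3)) set).
    trap T \<and> F \<subseteq> L3 \<and> embedded_submanifold 2 F \<and> trapped_family T F \<and> non_normal F"
proof (intro exI conjI)
  show "trap {mirror}" by (rule trap_mirror)
  show "family \<subseteq> L3" by (rule family_subset_L3)
  show "embedded_submanifold 2 family" by (rule embedded_submanifold_family)
  show "non_normal family" by (rule non_normal_family)
  have "\<Union>{mirror} \<subseteq> ball 0 2" using mirror_subset_ball by simp
  moreover have "\<exists>\<gamma>. billiard_trajectory {mirror} l \<gamma> \<and> nonsingular {mirror} \<gamma> \<and>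
    (\<exists>t\<^sub>0. \<forall>t. \<gamma> t \<in> cball 0 2 \<longleftrightarrow> t\<^sub>0 \<le> t)" if mem: "l \<in> family" for l
  proof -
    obtain u q where l: "l = oriented_line u q" "family_dir u" "family_focus q" "0 < q \<bullet> u"
      using mem unfolding family_def by blast
    have u3: "u $ 3 = 3/4" using l(2) unfolding family_dir_def by blast
    then have "outgoing q u"
      using l(3,4) family_dir_unit[OF l(2)] family_focus_unit[OF l(3)]
      by (simp add: outgoing_def family_focus_def)
    then show ?thesis unfolding l(1) by (rule outgoing_trajectory) (simp add: u3)
  qed
  ultimately show "trapped_family {mirror} family"
    unfolding trapped_family_def using family_subset_L3 embedded_submanifold_family by blast
qed

end
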